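(* Consider the second-order prediction method PTFM2, described in the context, and denote $f_k=v^{(0)}_k$. Let $f_0\le\frac{\pi_*}{4\kappa}$. Then for every iteration $k\ge0$ at which the method performs a predictor step and $f_k<f_0$, $$f_{k+1}\le\frac{5(n+1)(1+\kappa^2)c_3}{\pi_*\,r\,(f_0-f_k)}\,f_k^3\le(n+1)\left(\frac1\kappa+\kappa\right)\frac{5c_3f_k^3}{4\,r\,f_0(f_0-f_k)},$$ where $c_1=\sqrt{11+\frac{r^2}{8}}$ and $c_3=\left(1+\frac{c_1^2}{\sqrt2}\right)\left(1+2c_1+\frac{c_1^2}{\sqrt2}\right)$.
   Context: Problem. Let $A\in\mathbb{R}^{m\times n}$, $b\in\mathbb{R}^m$, $c\in\mathbb{R}^n$. The primal-dual pair is $\min\{\langle c,x\rangle: Ax=b,\ x\ge 0\}=\max\{\langle b,y\rangle: s+A^Ty=c,\ s\ge 0\}$. Let $\mathcal F_0=\{u=(x,s,y): Ax=b,\ s+A^Ty=c,\ x>0,\ s>0\}$, assumed nonempty. Non-degeneracy assumption: there is a unique primal solution $x^*$, with exactly $m$ positive components, which are the first $m$: $x^*=(x^*_B,0)$, $x^*_B>0$. In the partition $A=(A_B,A_N)$ the matrix $A_B\in\mathbb{R}^{m\times m}$ is non-degenerate. With $y^*=A_B^{-T}c_B$, $s_B^*=0$, it is assumed that $s^*_N=c_N-A_N^Ty^*>0$. Denote $x^*_{\min}=\min_{1\le i\le m}(x^* )^{(i)}$, $s^*_{\min}=\min_{m+1\le i\le n}(s^* )^{(i)}$, $\pi_*=x^*_{\min}s^*_{\min}$,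 $\kappa=\|A_B^{-1}A_N\|_\infty$ with $\|C\|_\infty=\max_{i,j}|C^{(i,j)}|$ for matrices. Notation. Products, powers and square roots of vectors are componentwise; $\|\cdot\|$ is the Euclidean norm; $\check e\in\mathbb{R}^n$ is the vector of ones. Control variables: $w=(v^{(0)},v)\in\mathcal F_p=\{(v^{(0)},v)\in\mathbb{R}_+\times\mathbb{R}^n: v^{(0)}>\|v\|^2\}$, $\rho(w)=\frac{v^{(0)}-\|v\|^2}{n+1}$. For $z=(u,w)$, $u=(x,s,y)$, the residual $r(z)\in\mathbb{R}^{n+1}$ has components $r^{(0)}(z)=v^{(0)}-\langle s,x\rangle$, $r^{(i)}(z)=x^{(i)}s^{(i)}-(v^{(i)})^2$ for $1\le i\le n$; $\check r(z)\in\mathbb{R}^n$ consists of components $1,\dots,n$. Let $\mathcal F=\{(u,w): u\in\mathcal F_0, w\in\mathcal F_p, r(z)\ge0\}$; its interior is given by $r(z)>0$. On the interior, $F(z)=-\sum_{i=0}^n\ln r^{(i)}(z)$ and $\Psi(z)=F(z)+(n+1)\ln\rho(w)\ge0$ is the functional proximity measure. For $k=0,1,2$ let $\chi_k(z)=\Big[\sum_{i=0}^n\frac{(r^{(i)}(z)-\rho(w))^2}{[r^{(i)}(z)]^k[\rho(w)]^{2-k}}\Big]^{1/2}$ and $\delta(z)=\chi_1^2(z)/\chi_2(z)$ ($\delta(z)=0$ if $\chi_2(z)=0$). For $u_k=(x_k,s_k,y_k)\in\mathcal F_0$ with $X_k=\mathrm{Diag}(x_k)$, $S_k=\mathrm{Diag}(s_k)$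 and $d\in\mathbb{R}^n$, $\Delta_k(d)=(\Delta^x,\Delta^s,\Delta^y)$ is the unique solution of $X_k\Delta^s+S_k\Delta^x=d$, $A\Delta^x=0$, $\Delta^s+A^T\Delta^y=0$. Let $\omega_*(\tau)=-\tau-\ln(1-\tau)$, $0\le\tau<1$. Method PTFM2. Choose $r\in(0,1)$, $A_\psi=\omega_*(r)$, $\beta=\frac{r}{2+r}$, $u_0=(x_0,s_0,y_0)\in\mathcal F_0$. With $\sigma=\min_i x_0^{(i)}s_0^{(i)}$, set $w_0=(v_0^{(0)},v_0)$ where $v_0^{(0)}=\langle s_0,x_0\rangle+\sigma$, $v_0^{(i)}=\sqrt{x_0^{(i)}s_0^{(i)}-\sigma}$. At iteration $k\ge0$, with $z_k=(u_k,w_k)$, $w_k=(v_k^{(0)},v_k)$: Predictor step (performed if $\delta(z_k)\le\beta$): set $\tilde d_k=\frac{\|v_k\|^2}{n+1}\check e-v_k^2-x_ks_k$, $\tilde\Delta_k=\Delta_k(\tilde d_k)$; set $\widehat d_k=v_k^2-\frac{\|v_k\|^2}{n+1}\check e-\tilde\Delta_k^x\tilde\Delta_k^s$, $\widehat\Delta_k=\Delta_k(\widehat d_k)$; take $\alpha_k\in(0,1)$ a solution of $\Psi(u_k+\alpha\tilde\Delta_k+\alpha^2\widehat\Delta_k,(1-\alpha)w_k)=A_\psi$ (with the point in the interior of $\mathcal F$), and set $u_{k+1}=u_k+\alpha_k\tilde\Delta_k+\alpha_k^2\widehat\Delta_k$, $w_{k+1}=(1-\alpha_k)w_k$. Corrector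 step (otherwise): set $d_k=\rho(w_k)\check e-\check r(z_k)$, $\Delta_k=\Delta_k(d_k)$, take $\alpha_k\ge0$ an approximate minimizer of $F(u_k+\alpha\Delta_k,w_k)$ over $\alpha\ge0$, and set $u_{k+1}=u_k+\alpha_k\Delta_k$, $w_{k+1}=w_k$. Stop if $v_k^{(0)}\le\epsilon$ and $\delta(z_k)\le\beta$. *)

theory Defs
  imports "HOL-Analysis.Analysis"
begin

text \<open>
  Columns of the constraint matrix are indexed by a finite type \<open>'n\<close> and rows by \<open>'m\<close>.  On
  \<open>real ^ 'n\<close> the library's \<open>*\<close>, \<open>^\<close> and \<open>1\<close> are the componentwise product,
  the componentwise power and the vector of ones.
\<close>

type_synonym ('n, 'm) pd_point = "(real ^ 'n) \<times> (real ^ 'n) \<times> (real ^ 'm)"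
type_synonym 'n control = "real \<times> (real ^ 'n)"
type_synonym ('n, 'm) state = "('n, 'm) pd_point \<times> 'n control"

subsection \<open>The linear program and its non-degenerate solution\<close>

definition primal_feasible :: "real ^ 'n ^ 'm \<Rightarrow> real ^ 'm \<Rightarrow> (real ^ 'n) set" where
  "primal_feasible A b = {x. A *v x = b \<and> (\<forall>i. x $ i \<ge> 0)}"

definition primal_solution ::
  "real ^ 'n ^ 'm \<Rightarrow> real ^ 'm \<Rightarrow> real ^ 'n \<Rightarrow> real ^ 'n \<Rightarrow> bool" where
  "primal_solution A b c x \<longleftrightarrow>
     x \<in> primal_feasible A b \<and> (\<forall>x' \<in> primal_feasible A b. c \<bullet> x \<le> c \<bullet> x')"

definition strictly_feasible ::
  "real ^ 'n ^ 'm \<Rightarrow> real ^ 'm \<Rightarrow> real ^ 'n \<Rightarrow> ('n, 'm) pd_point set" where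
  "strictly_feasible A b c =
     {(x, s, y). A *v x = b \<and> s + transpose A *v y = c \<and>
                 (\<forall>i. x $ i > 0) \<and> (\<forall>i. s $ i > 0)}"

text \<open>
  The partition into basic and non-basic components is built into the column index type
  \<open>'m + 'k\<close>: the ``first \<open>m\<close>'' indices are those of the form \<open>Inl i\<close>.
\<close>

definition basic_block :: "real ^ ('m::finite + 'k::finite) ^ 'm \<Rightarrow> real ^ 'm ^ 'm" where
  "basic_block A = (\<chi> i j. A $ i $ Inl j)"

definition nonbasic_block :: "real ^ ('m::finite + 'k::finite) ^ 'm \<Rightarrow> real ^ 'k ^ 'm" where
  "nonbasic_block A = (\<chi> i j. A $ i $ Inr j)"

definition basic_part :: "real ^ ('m::finite + 'k::finite) \<Rightarrow> real ^ 'm" where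
  "basic_part c = (\<chi> i. c $ Inl i)"

definition nonbasic_part :: "real ^ ('m::finite + 'k::finite) \<Rightarrow> real ^ 'k" where
  "nonbasic_part c = (\<chi> j. c $ Inr j)"

definition y_star ::
  "real ^ ('m::finite + 'k::finite) ^ 'm \<Rightarrow> real ^ ('m + 'k) \<Rightarrow> real ^ 'm" where
  "y_star A c = matrix_inv (transpose (basic_block A)) *v basic_part c"

definition s_star ::
  "real ^ ('m::finite + 'k::finite) ^ 'm \<Rightarrow> real ^ ('m + 'k) \<Rightarrow> real ^ ('m + 'k)" where
  "s_star A c = (\<chi> j. case j of
       Inl i \<Rightarrow> 0
     | Inr l \<Rightarrow> (nonbasic_part c - transpose (nonbasic_block A) *v y_star A c) $ l)"

definition pi_star ::
  "real ^ ('m::finite + 'k::finite) ^ 'm \<Rightarrow> real ^ ('m + 'k) \<Rightarrow> real ^ ('m + 'k) \<Rightarrow> real" where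
  "pi_star A c xs =
     Min (range (\<lambda>i::'m. xs $ Inl i)) * Min (range (\<lambda>l::'k. s_star A c $ Inr l))"

definition max_entry :: "real ^ 'k ^ 'm \<Rightarrow> real" where
  "max_entry C = Max (range (\<lambda>(i, j). \<bar>C $ i $ j\<bar>))"

definition kappa :: "real ^ ('m::finite + 'k::finite) ^ 'm \<Rightarrow> real" where
  "kappa A = max_entry (matrix_inv (basic_block A) ** nonbasic_block A)"

subsection \<open>Residuals and proximity measures\<close>

definition control_set :: "'n::finite control set" where
  "control_set = {(v0, v). v0 \<ge> 0 \<and> v0 > (norm v)\<^sup>2}"

definition rho :: "'n::finite control \<Rightarrow> real" where
  "rho w = (fst w - (norm (snd w))\<^sup>2) / (real CARD('n) + 1)"

text \<open>
  The index set \<open>0, \<dots>, n\<close> of the residual is \<open>'n option\<close>, with \<open>None\<close> for \<open>0\<close>.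
\<close>

definition residual :: "('n::finite, 'm) state \<Rightarrow> real ^ 'n option" where
  "residual z = (case z of ((x, s, y), (v0, v)) \<Rightarrow>
     (\<chi> j. case j of None \<Rightarrow> v0 - s \<bullet> x | Some i \<Rightarrow> x $ i * s $ i - (v $ i)\<^sup>2))"

definition residual_check :: "('n::finite, 'm) state \<Rightarrow> real ^ 'n" where
  "residual_check z = (\<chi> i. residual z $ Some i)"

definition interior_F ::
  "real ^ 'n ^ 'm \<Rightarrow> real ^ 'm \<Rightarrow> real ^ 'n::finite \<Rightarrow> ('n, 'm) state set" where
  "interior_F A b c =
     {(u, w). u \<in> strictly_feasible A b c \<and> w \<in> control_set \<and>
              (\<forall>j. residual (u, w) $ j > 0)}"

definition barrier :: "('n::finite, 'm) state \<Rightarrow> real" where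
  "barrier z = - (\<Sum>j\<in>UNIV. ln (residual z $ j))"

definition Psi :: "('n::finite, 'm) state \<Rightarrow> real" where
  "Psi z = barrier z + (real CARD('n) + 1) * ln (rho (snd z))"

text \<open>Used for \<open>k = 0, 1, 2\<close> only, so that the subtraction in the exponent is exact.\<close>

definition prox :: "nat \<Rightarrow> ('n::finite, 'm) state \<Rightarrow> real" where
  "prox k z = sqrt (\<Sum>j\<in>UNIV. (residual z $ j - rho (snd z))\<^sup>2 /
                       ((residual z $ j) ^ k * (rho (snd z)) ^ (2 - k)))"

definition prox_delta :: "('n::finite, 'm) state \<Rightarrow> real" where
  "prox_delta z = (if prox 2 z = 0 then 0 else (prox 1 z)\<^sup>2 / prox 2 z)"

definition omega_star :: "real \<Rightarrow> real" where
  "omega_star t = - t - ln (1 - t)"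

subsection \<open>The second-order parabolic target-following method\<close>

text \<open>
  The system has exactly one solution when \<open>x\<close> and \<open>s\<close> are positive and \<open>A\<close> has full row
  rank, in particular when its basic block is invertible.
\<close>

definition direction ::
  "real ^ 'n ^ 'm \<Rightarrow> ('n::finite, 'm::finite) pd_point \<Rightarrow> real ^ 'n \<Rightarrow> ('n, 'm) pd_point" where
  "direction A u d = (case u of (x, s, y) \<Rightarrow>
     (THE (dx, ds, dy). x * ds + s * dx = d \<and> A *v dx = 0 \<and> ds + transpose A *v dy = 0))"

definition initial_state :: "('n::finite, 'm) pd_point \<Rightarrow> ('n, 'm) state" where
  "initial_state u = (case u of (x, s, y) \<Rightarrow>
     let \<sigma> = Min (range (\<lambda>i. x $ i * s $ i))
     in (u, (s \<bullet> x + \<sigma>, (\<chi> i. sqrt (x $ i * s $ i - \<sigma>)))))"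

definition predictor_test :: "real \<Rightarrow> ('n::finite, 'm) state \<Rightarrow> bool" where
  "predictor_test r z \<longleftrightarrow> prox_delta z \<le> r / (2 + r)"

definition predictor_step ::
  "real ^ 'n ^ 'm \<Rightarrow> real ^ 'm \<Rightarrow> real ^ 'n \<Rightarrow> real \<Rightarrow>
   ('n::finite, 'm::finite) state \<Rightarrow> ('n, 'm) state \<Rightarrow> bool" where
  "predictor_step A b c r z z' \<longleftrightarrow> (case z of ((x, s, y), (v0, v)) \<Rightarrow>
     let u = (x, s, y);
         w = (v0, v);
         mu = (norm v)\<^sup>2 / (real CARD('n) + 1);
         D1 = direction A u (mu *\<^sub>R 1 - v\<^sup>2 - x * s);
         D2 = direction A u (v\<^sup>2 - mu *\<^sub>R 1 - fst D1 * fst (snd D1))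
     in \<exists>\<alpha>. 0 < \<alpha> \<and> \<alpha> < 1 \<and>
          z' = (u + \<alpha> *\<^sub>R D1 + \<alpha>\<^sup>2 *\<^sub>R D2, (1 - \<alpha>) *\<^sub>R w) \<and>
          z' \<in> interior_F A b c \<and> Psi z' = omega_star r)"

text \<open>
  The step size of the corrector step is a minimizer, over all \<open>\<alpha> \<ge> 0\<close> in the domain of the
  barrier, up to an additive error of at most \<open>\<eta>\<close>.
\<close>

definition corrector_step ::
  "real ^ 'n ^ 'm \<Rightarrow> real ^ 'm \<Rightarrow> real ^ 'n \<Rightarrow> real \<Rightarrow>
   ('n::finite, 'm::finite) state \<Rightarrow> ('n, 'm) state \<Rightarrow> bool" where
  "corrector_step A b c \<eta> z z' \<longleftrightarrow>
     (let u = fst z;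
          w = snd z;
          D = direction A u (rho w *\<^sub>R 1 - residual_check z)
      in \<exists>\<alpha>\<ge>0.
           z' = (u + \<alpha> *\<^sub>R D, w) \<and> z' \<in> interior_F A b c \<and>
           (\<forall>t\<ge>0. (u + t *\<^sub>R D, w) \<in> interior_F A b c \<longrightarrow>
                   barrier z' \<le> barrier (u + t *\<^sub>R D, w) + \<eta>))"

definition stopping_test :: "real \<Rightarrow> real \<Rightarrow> ('n::finite, 'm) state \<Rightarrow> bool" where
  "stopping_test \<epsilon> r z \<longleftrightarrow> fst (snd z) \<le> \<epsilon> \<and> predictor_test r z"

text \<open>
  \<open>ptfm2_run A b c r \<epsilon> \<eta> K z\<close>: the points \<open>z 0, \<dots>, z K\<close> are generated by the first \<open>K\<close>
  iterations of the method, where \<open>\<eta> k\<close> is the accuracy of the line search if iteration \<open>k\<close> is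
  a corrector step.  The number \<open>K\<close> is arbitrary because the method may stop after finitely
  many iterations.
\<close>

definition ptfm2_run ::
  "real ^ 'n ^ 'm \<Rightarrow> real ^ 'm \<Rightarrow> real ^ 'n \<Rightarrow> real \<Rightarrow> real \<Rightarrow> (nat \<Rightarrow> real) \<Rightarrow> nat \<Rightarrow>
   (nat \<Rightarrow> ('n::finite, 'm::finite) state) \<Rightarrow> bool" where
  "ptfm2_run A b c r \<epsilon> \<eta> K z \<longleftrightarrow>
     (\<exists>u0 \<in> strictly_feasible A b c. z 0 = initial_state u0) \<and>
     (\<forall>k<K. \<not> stopping_test \<epsilon> r (z k) \<and>
        (if predictor_test r (z k)
         then predictor_step A b c r (z k) (z (Suc k))
         else corrector_step A b c (\<eta> k) (z k) (z (Suc k))))"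

definition c1 :: "real \<Rightarrow> real" where
  "c1 r = sqrt (11 + r\<^sup>2 / 8)"

definition c3 :: "real \<Rightarrow> real" where
  "c3 r = (1 + (c1 r)\<^sup>2 / sqrt 2) * (1 + 2 * c1 r + (c1 r)\<^sup>2 / sqrt 2)"

end

theory Submission
  imports Defs
begin

text \<open>
  Write \<open>f\<close> for the current value of \<open>v\<^sup>(\<^sup>0\<^sup>)\<close>, \<open>\<alpha>\<close> for the predictor step size,
  \<open>\<mu> = \<parallel>v\<parallel>\<^sup>2 / (n + 1)\<close>, and \<open>(dx, ds)\<close>, \<open>(dx', ds')\<close> for the first and second predictor
  directions.  All estimates are made in the \<open>l\<^sub>1\<close> norm.

  The control is only ever scaled, so \<open>w = (f / f\<^sub>0) w\<^sub>0\<close> throughout the run.  As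
  \<open>\<parallel>v\<^sub>0\<parallel>\<^sup>2 \<le> f\<^sub>0\<close>, this gives \<open>\<parallel>v\<parallel>\<^sup>2 \<le> f\<^sup>2 / f\<^sub>0\<close> and hence
  \<open>(n + 1) \<rho> \<ge> f (f\<^sub>0 - f) / f\<^sub>0\<close>.

  The second-order correction is designed so that the new residuals are exactly
  \<open>(1 - \<alpha>) (r\<^sup>(\<^sup>i\<^sup>) + \<alpha> \<mu>) + e\<^sub>i\<close> and the new average residual is exactly
  \<open>(1 - \<alpha>) (\<rho> + \<alpha> \<mu>)\<close>, with an error
  \<open>e = \<alpha>\<^sup>3 (dx ds' + dx' ds) + \<alpha>\<^sup>4 dx' ds'\<close> whose entries sum to zero
  (\<open>predictor_residual\<close>).  Near the non-degenerate vertex \<open>e\<close> is of third order in \<open>f\<close>.  Indeed a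
  direction in the tangent space is controlled through \<open>\<kappa>\<close> by its small components, which are
  \<open>ds\<close> on the basic and \<open>dx\<close> on the non-basic indices (\<open>tangent_bounds\<close>).  These are bounded by
  the right-hand side of the linear system (\<open>direction_size\<close>), because \<open>f \<le> \<pi>\<^sub>* / (4 \<kappa>)\<close> keeps
  the large components of \<open>x\<close> and \<open>s\<close> above three quarters of their limits (\<open>near_vertex\<close>).
  The outcome is \<open>\<Sum>\<bar>e\<^sub>i\<bar> \<le> 241 \<kappa> f\<^sup>3 / (f\<^sub>0 \<pi>\<^sub>*)\<close> (\<open>predictor_error\<close>).

  On the other side, \<open>\<delta> \<le> r / (2 + r)\<close> forces the residuals to be so close to \<open>\<rho>\<close> that an error
  with \<open>\<Sum>\<bar>e\<^sub>i\<bar> \<le> (1 - \<alpha>) \<rho> r / 5\<close> leaves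
  \<open>\<Psi> < r\<^sup>2 / 2 \<le> \<omega>\<^sub>*(r)\<close> at the new point (\<open>barrier_perturbation\<close>, \<open>Psi_after_predictor\<close>).
  The step size rule demands \<open>\<Psi> = \<omega>\<^sub>*(r)\<close>, so \<open>1 - \<alpha>\<close> must be at most of the order
  \<open>\<kappa> f\<^sup>3 / (f\<^sub>0 \<pi>\<^sub>* r \<rho>)\<close>.  With the lower bound on \<open>\<rho>\<close>,
  \<open>2 \<kappa> \<le> 1 + \<kappa>\<^sup>2\<close> and \<open>c\<^sub>3 \<ge> 121\<close> this is the claim.
\<close>

section \<open>Directions\<close>

text \<open>
  The primal and dual parts \<open>(dx, ds)\<close> of displacements that preserve the two equality constraints.
  The \<open>y\<close>-part is left implicit because residuals do not involve it.
\<close>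

definition tangent :: "real ^ 'n ^ 'm \<Rightarrow> real ^ 'n \<Rightarrow> real ^ 'n \<Rightarrow> bool" where
  "tangent A dx ds \<longleftrightarrow> A *v dx = 0 \<and> (\<exists>dy. ds + transpose A *v dy = 0)"

lemma tangent_orthogonal:
  assumes "tangent A dx ds" "tangent A dx' ds'"
  shows "(\<Sum>j\<in>UNIV. dx $ j * ds' $ j) = 0"
proof -
  obtain dy where dy: "ds' + transpose A *v dy = 0"
    using assms(2) unfolding tangent_def by blast
  have "ds' = - (dy v* A)"
    using dy by (simp add: eq_neg_iff_add_eq_0)
  then have "dx \<bullet> ds' = - ((dy v* A) \<bullet> dx)"
    by (simp add: inner_commute)
  also have "\<dots> = - (dy \<bullet> (A *v dx))"
    by (simp only: dot_lmul_matrix)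
  finally show ?thesis
    using assms(1) by (simp add: tangent_def inner_vec_def)
qed

lemma direction_unique_zero:
  fixes A :: "real ^ ('m::finite + 'k::finite) ^ 'm"
  assumes inv: "invertible (basic_block A)"
    and pos: "\<And>j. x $ j > 0" "\<And>j. s $ j > 0"
    and eqs: "x * ds + s * dx = 0" "A *v dx = 0" "ds + transpose A *v dy = 0"
  shows "dx = 0 \<and> ds = 0 \<and> dy = 0"
proof -
  have c: "x $ j * ds $ j = - (s $ j * dx $ j)" for j
    using eqs(1) by (metis add_eq_0_iff2 vector_add_component vector_mult_component zero_index)
  have ds: "ds $ j = - (s $ j / x $ j) * dx $ j" for j
    using c[of j] pos[of j] by (simp add: field_simps)
  have "tangent A dx ds" using eqs by (auto simp: tangent_def)
  then have "(\<Sum>j\<in>UNIV. dx $ j * ds $ j) = 0" using tangent_orthogonal by blast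
  then have "(\<Sum>j\<in>UNIV. s $ j / x $ j * (dx $ j)\<^sup>2) = 0"
    by (simp add: ds power2_eq_square algebra_simps sum_negf)
  then have "s $ j / x $ j * (dx $ j)\<^sup>2 = 0" for j
    using pos by (subst (asm) sum_nonneg_eq_0_iff) (auto simp: less_imp_le)
  then have dx0: "dx = 0"
    using pos by (simp add: vec_eq_iff less_imp_neq[symmetric] less_imp_le)
  then have ds0: "ds = 0" using ds by (simp add: vec_eq_iff)
  have "transpose (basic_block A) *v dy = 0"
    using eqs(3) ds0 by (auto simp: vec_eq_iff matrix_vector_mult_def transpose_def basic_block_def)
  moreover have "invertible (transpose (basic_block A))" using inv by (rule transpose_invertible)
  ultimately have "dy = 0"
    using matrix_left_invertible_ker[of "transpose (basic_block A)"]
    by (auto simp: invertible_def)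
  with dx0 ds0 show ?thesis by simp
qed

text \<open>
  The linear operator of the Newton system is injective on a finite-dimensional space, hence
  bijective, and the description by \<open>THE\<close> defines an actual solution.
\<close>

lemma direction_eqs:
  fixes A :: "real ^ ('m::finite + 'k::finite) ^ 'm"
  assumes inv: "invertible (basic_block A)"
    and pos: "\<And>j. x $ j > 0" "\<And>j. s $ j > 0"
    and D: "direction A (x, s, y) d = (dx, ds, dy)"
  shows "x * ds + s * dx = d" and "tangent A dx ds"
proof -
  define L where "L = (\<lambda>(dx, ds, dy). (x * ds + s * dx, ds + transpose A *v dy, A *v dx))"
  have L: "L (dx, ds, dy) = (x * ds + s * dx, ds + transpose A *v dy, A *v dx)" for dx ds dy
    by (simp only: L_def prod.case)
  have lin: "linear L"
  proof (rule linearI)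
    have m: "x * (r *\<^sub>R a) = r *\<^sub>R (x * a)" for r and x a :: "real ^ ('m + 'k)"
      by (simp add: vec_eq_iff)
    show "L (p + q) = L p + L q" for p q
      by (cases p; cases q) (simp add: L distrib_left matrix_vector_right_distrib
          del: transpose_matrix_vector)
    show "L (r *\<^sub>R p) = r *\<^sub>R L p" for r p
      by (cases p) (simp add: L m scaleR_add_right matrix_vector_mult_scaleR
          del: transpose_matrix_vector)
  qed
  have inj: "inj L"
  proof (rule iffD2[OF linear_injective_0[OF lin]], intro allI impI)
    fix p assume "L p = 0"
    then show "p = 0"
      using direction_unique_zero[OF inv pos, where dx = "fst p" and ds = "fst (snd p)" and dy = "snd (snd p)"]
      by (cases p) (simp add: L zero_prod_def)
  qed
  then have "surj L" using linear_injective_imp_surjective[OF lin] by blast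
  then obtain p where p: "L p = (d, 0, 0)" by (metis surjD)
  have L_iff: "L q = (d, 0, 0) \<longleftrightarrow> (case q of (dx, ds, dy) \<Rightarrow>
      x * ds + s * dx = d \<and> A *v dx = 0 \<and> ds + transpose A *v dy = 0)" for q
    by (cases q) (simp only: L prod.case prod.inject conj_ac)
  have "\<exists>!q. L q = (d, 0, 0)"
    using p inj by (metis injD)
  then have "L (THE q. L q = (d, 0, 0)) = (d, 0, 0)" by (rule theI')
  moreover have "(THE q. L q = (d, 0, 0)) = (dx, ds, dy)"
    using D unfolding direction_def prod.case L_iff .
  ultimately have "L (dx, ds, dy) = (d, 0, 0)" by (simp only:)
  then show "x * ds + s * dx = d" "tangent A dx ds"
    by (auto simp only: L tangent_def prod.inject)
qed

lemma sum_UNIV_Plus: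
  "(\<Sum>j\<in>UNIV. g (j :: 'm::finite + 'k::finite)) = (\<Sum>i\<in>UNIV. g (Inl i)) + (\<Sum>l\<in>UNIV. g (Inr l))"
  using sum.Plus[of "UNIV :: 'm set" "UNIV :: 'k set" g] by simp

lemma max_entry_ge: "\<bar>C $ i $ j\<bar> \<le> max_entry C"
  unfolding max_entry_def by (rule Max_ge) (auto intro!: image_eqI[of _ _ "(i,j)"])

text \<open>
  On the tangent space \<open>dx\<^sub>B = - C dx\<^sub>N\<close> and \<open>ds\<^sub>N = C\<^sup>T ds\<^sub>B\<close> for
  \<open>C = A\<^sub>B\<^sup>-\<^sup>1 A\<^sub>N\<close>, whose entries are bounded by \<open>\<kappa>\<close>.
\<close>

lemma tangent_bounds:
  fixes A :: "real ^ ('m::finite + 'k::finite) ^ 'm"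
  assumes inv: "invertible (basic_block A)" and tan: "tangent A dx ds"
  shows "\<bar>dx $ Inl i\<bar> \<le> kappa A * (\<Sum>l\<in>UNIV. \<bar>dx $ Inr l\<bar>)"
    and "\<bar>ds $ Inr l\<bar> \<le> kappa A * (\<Sum>i\<in>UNIV. \<bar>ds $ Inl i\<bar>)"
proof -
  let ?B = "basic_block A" and ?N = "nonbasic_block A"
  let ?C = "matrix_inv ?B ** ?N"
  obtain dy where A0: "A *v dx = 0" and dy: "ds + transpose A *v dy = 0"
    using tan unfolding tangent_def by blast
  have lBB: "matrix_inv ?B ** ?B = mat 1" and rBB: "?B ** matrix_inv ?B = mat 1"
    using someI_ex[OF inv[unfolded invertible_def]]
    by (auto simp: matrix_inv_def)
  have bd: "\<bar>?C $ i $ j\<bar> \<le> kappa A" for i j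
    unfolding kappa_def by (rule max_entry_ge)
  have "?B *v basic_part dx + ?N *v nonbasic_part dx = A *v dx"
    by (simp add: vec_eq_iff matrix_vector_mult_def basic_block_def nonbasic_block_def
        basic_part_def nonbasic_part_def sum_UNIV_Plus)
  then have "matrix_inv ?B *v (?B *v basic_part dx + ?N *v nonbasic_part dx) = 0"
    using A0 by simp
  then have "basic_part dx = - (?C *v nonbasic_part dx)"
    by (simp add: matrix_vector_right_distrib matrix_vector_mul_assoc lBB eq_neg_iff_add_eq_0)
  then have "dx $ Inl i = - (\<Sum>l\<in>UNIV. ?C $ i $ l * dx $ Inr l)"
    by (simp add: vec_eq_iff basic_part_def nonbasic_part_def matrix_vector_mult_def[of ?C])
  then have "\<bar>dx $ Inl i\<bar> \<le> (\<Sum>l\<in>UNIV. \<bar>?C $ i $ l * dx $ Inr l\<bar>)"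
    by (simp only: abs_minus_cancel sum_abs)
  also have "\<dots> \<le> (\<Sum>l\<in>UNIV. kappa A * \<bar>dx $ Inr l\<bar>)"
    by (intro sum_mono) (auto simp: abs_mult intro!: mult_right_mono bd)
  finally show "\<bar>dx $ Inl i\<bar> \<le> kappa A * (\<Sum>l\<in>UNIV. \<bar>dx $ Inr l\<bar>)"
    by (simp add: sum_distrib_left)
  have 1: "basic_part ds = - (transpose ?B *v dy)"
    using dy by (auto simp: vec_eq_iff basic_part_def basic_block_def matrix_vector_mult_def
        transpose_def eq_neg_iff_add_eq_0)
  have 2: "nonbasic_part ds = - (transpose ?N *v dy)"
    using dy by (auto simp: vec_eq_iff nonbasic_part_def nonbasic_block_def matrix_vector_mult_def
        transpose_def eq_neg_iff_add_eq_0)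
  have "transpose ?C *v basic_part ds = - (transpose ?C *v (transpose ?B *v dy))"
    by (simp only: 1 linear_neg[OF matrix_vector_mul_linear])
  also have "transpose ?C *v (transpose ?B *v dy) = transpose (?B ** ?C) *v dy"
    by (simp only: matrix_vector_mul_assoc matrix_transpose_mul)
  also have "?B ** ?C = ?N"
    by (simp only: matrix_mul_assoc rBB matrix_mul_lid)
  finally have "nonbasic_part ds = transpose ?C *v basic_part ds" using 2 by (simp only:)
  then have "ds $ Inr l = (\<Sum>i\<in>UNIV. ?C $ i $ l * ds $ Inl i)"
    by (simp add: vec_eq_iff basic_part_def nonbasic_part_def del: transpose_matrix_vector)
      (simp add: matrix_vector_mult_def transpose_def[of ?C])
  then have "\<bar>ds $ Inr l\<bar> \<le> (\<Sum>i\<in>UNIV. \<bar>?C $ i $ l * ds $ Inl i\<bar>)"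
    by (simp only: sum_abs)
  also have "\<dots> \<le> (\<Sum>i\<in>UNIV. kappa A * \<bar>ds $ Inl i\<bar>)"
    by (intro sum_mono) (auto simp: abs_mult intro!: mult_right_mono bd)
  finally show "\<bar>ds $ Inr l\<bar> \<le> kappa A * (\<Sum>i\<in>UNIV. \<bar>ds $ Inl i\<bar>)"
    by (simp add: sum_distrib_left)
qed

section \<open>Estimates near the non-degenerate vertex\<close>

text \<open>
  The \<open>l\<^sub>1\<close> size of the components of \<open>(dx, ds)\<close> that belong to the vanishing parts of the optimal
  pair.  The weights \<open>p\<close> and \<open>q\<close> stand for the least positive entries of \<open>x\<^sup>*\<close> and
  \<open>s\<^sup>*\<close>, so that their product is \<open>\<pi>\<^sub>*\<close>.
\<close>

definition small_part_size :: "real \<Rightarrow> real \<Rightarrow> real ^ ('m::finite + 'k::finite) \<Rightarrow> real ^ ('m + 'k) \<Rightarrow> real"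
  where "small_part_size p q dx ds =
    p * (\<Sum>i\<in>UNIV. \<bar>ds $ Inl i\<bar>) + q * (\<Sum>l\<in>UNIV. \<bar>dx $ Inr l\<bar>)"

lemma kappa_nonneg: "0 \<le> kappa A"
  unfolding kappa_def using order_trans[OF abs_ge_zero max_entry_ge] .

lemma tangent_product_bound:
  fixes A :: "real ^ ('m::finite + 'k::finite) ^ 'm"
  assumes inv: "invertible (basic_block A)" and "tangent A dx ds" "tangent A dx' ds'"
  shows "(\<Sum>j\<in>UNIV. \<bar>dx $ j * ds' $ j\<bar>)
    \<le> 2 * kappa A * ((\<Sum>l\<in>UNIV. \<bar>dx $ Inr l\<bar>) * (\<Sum>i\<in>UNIV. \<bar>ds' $ Inl i\<bar>))"
proof -
  let ?X = "\<Sum>l\<in>UNIV. \<bar>dx $ Inr l\<bar>" and ?S = "\<Sum>i\<in>UNIV. \<bar>ds' $ Inl i\<bar>"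
  have "(\<Sum>i\<in>UNIV. \<bar>dx $ Inl i * ds' $ Inl i\<bar>) \<le> (\<Sum>i\<in>UNIV. kappa A * ?X * \<bar>ds' $ Inl i\<bar>)"
    by (intro sum_mono) (auto simp: abs_mult intro!: mult_right_mono tangent_bounds(1)[OF inv assms(2)])
  moreover have "(\<Sum>l\<in>UNIV. \<bar>dx $ Inr l * ds' $ Inr l\<bar>) \<le> (\<Sum>l\<in>UNIV. \<bar>dx $ Inr l\<bar> * (kappa A * ?S))"
    by (intro sum_mono) (auto simp: abs_mult intro!: mult_left_mono tangent_bounds(2)[OF inv assms(3)])
  ultimately show ?thesis
    by (simp add: sum_UNIV_Plus algebra_simps flip: sum_distrib_left sum_distrib_right)
qed

lemma tangent_products_le:
  fixes A :: "real ^ ('m::finite + 'k::finite) ^ 'm"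
  assumes inv: "invertible (basic_block A)" and t: "tangent A dx ds" "tangent A dx' ds'"
    and pq: "0 < p" "0 < q"
  shows "(\<Sum>j\<in>UNIV. \<bar>dx $ j * ds' $ j + dx' $ j * ds $ j\<bar>)
      \<le> 2 * kappa A / (p * q) * (small_part_size p q dx ds * small_part_size p q dx' ds')" (is ?cross)
    and "(\<Sum>j\<in>UNIV. \<bar>dx $ j * ds $ j\<bar>)
      \<le> kappa A / (2 * (p * q)) * (small_part_size p q dx ds)\<^sup>2" (is ?diag)
proof -
  define X S X' S' where defs: "X = (\<Sum>l\<in>UNIV. \<bar>dx $ Inr l\<bar>)" "S = (\<Sum>i\<in>UNIV. \<bar>ds $ Inl i\<bar>)"
    "X' = (\<Sum>l\<in>UNIV. \<bar>dx' $ Inr l\<bar>)" "S' = (\<Sum>i\<in>UNIV. \<bar>ds' $ Inl i\<bar>)"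
  have nn: "0 \<le> X" "0 \<le> S" "0 \<le> X'" "0 \<le> S'" by (auto simp: defs sum_nonneg)
  have sz: "small_part_size p q dx ds = p * S + q * X" "small_part_size p q dx' ds' = p * S' + q * X'"
    by (simp_all add: small_part_size_def defs)
  have k: "0 \<le> kappa A" by (rule kappa_nonneg)
  have "(\<Sum>j\<in>UNIV. \<bar>dx $ j * ds' $ j + dx' $ j * ds $ j\<bar>)
      \<le> (\<Sum>j\<in>UNIV. \<bar>dx $ j * ds' $ j\<bar>) + (\<Sum>j\<in>UNIV. \<bar>dx' $ j * ds $ j\<bar>)"
    by (simp add: abs_triangle_ineq sum_mono flip: sum.distrib)
  also have "\<dots> \<le> 2 * kappa A * (X * S') + 2 * kappa A * (X' * S)"
    unfolding defs by (intro add_mono tangent_product_bound[OF inv t(1,2)] tangent_product_bound[OF inv t(2,1)])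
  also have "\<dots> = 2 * kappa A / (p * q) * (p * q * (X * S' + X' * S))"
    using pq by (simp add: field_simps)
  also have "\<dots> \<le> 2 * kappa A / (p * q) * ((p * S + q * X) * (p * S' + q * X'))"
  proof (rule mult_left_mono)
    have "0 \<le> p\<^sup>2 * (S * S') + q\<^sup>2 * (X * X')" using nn by simp
    then show "p * q * (X * S' + X' * S) \<le> (p * S + q * X) * (p * S' + q * X')"
      by (simp add: algebra_simps power2_eq_square)
  qed (use k pq in simp)
  finally show ?cross by (simp add: sz)
  have "(\<Sum>j\<in>UNIV. \<bar>dx $ j * ds $ j\<bar>) \<le> 2 * kappa A * (X * S)"
    unfolding defs by (rule tangent_product_bound[OF inv t(1,1)])
  also have "\<dots> = kappa A / (2 * (p * q)) * (4 * (p * S) * (q * X))"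
    using pq by (simp add: field_simps)
  also have "\<dots> \<le> kappa A / (2 * (p * q)) * (p * S + q * X)\<^sup>2"
  proof (rule mult_left_mono)
    have "0 \<le> (p * S - q * X)\<^sup>2" by simp
    then show "4 * (p * S) * (q * X) \<le> (p * S + q * X)\<^sup>2"
      by (simp add: algebra_simps power2_eq_square)
  qed (use k pq in simp)
  finally show ?diag by (simp add: sz)
qed

text \<open>
  Solving the equations \<open>x ds + s dx = d\<close> for \<open>ds\<close> on basic and for \<open>dx\<close> on non-basic indices gives
  a nearly decoupled system: the coupling coefficients are at most one quarter, by \<open>\<kappa> f \<le> p q / 4\<close>.
\<close>

lemma direction_size:
  fixes A :: "real ^ ('m::finite + 'k::finite) ^ 'm"
  assumes inv: "invertible (basic_block A)" and t: "tangent A dx ds"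
    and eq: "x * ds + s * dx = d"
    and pq: "0 < p" "0 < q"
    and pos: "\<And>j. 0 < x $ j" "\<And>j. 0 < s $ j"
    and large: "\<And>i. 3/4 * p \<le> x $ Inl i" "\<And>l. 3/4 * q \<le> s $ Inr l"
    and small: "p * (\<Sum>i\<in>UNIV. s $ Inl i) \<le> f" "q * (\<Sum>l\<in>UNIV. x $ Inr l) \<le> f"
    and kf: "kappa A * f \<le> p * q / 4"
  shows "small_part_size p q dx ds \<le> 2 * (\<Sum>j\<in>UNIV. \<bar>d $ j\<bar>)"
proof -
  define X S where defs: "X = (\<Sum>l\<in>UNIV. \<bar>dx $ Inr l\<bar>)" "S = (\<Sum>i\<in>UNIV. \<bar>ds $ Inl i\<bar>)"
  have nn: "0 \<le> X" "0 \<le> S" by (auto simp: defs sum_nonneg)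
  have k: "0 \<le> kappa A" by (rule kappa_nonneg)
  have dj: "x $ j * ds $ j + s $ j * dx $ j = d $ j" for j
    using eq by (auto simp: vec_eq_iff)
  have "3/4 * p * \<bar>ds $ Inl i\<bar> \<le> \<bar>d $ Inl i\<bar> + s $ Inl i * (kappa A * X)" for i
  proof -
    have "3/4 * p * \<bar>ds $ Inl i\<bar> \<le> \<bar>x $ Inl i * ds $ Inl i\<bar>"
      unfolding abs_mult using large(1)[of i] by (intro mult_right_mono) auto
    also have "\<dots> \<le> \<bar>d $ Inl i\<bar> + \<bar>s $ Inl i * dx $ Inl i\<bar>"
      using dj[of "Inl i"] by linarith
    also have "\<bar>s $ Inl i * dx $ Inl i\<bar> \<le> s $ Inl i * (kappa A * X)"
      using pos(2)[of "Inl i"] tangent_bounds(1)[OF inv t, of i]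
      by (simp add: abs_mult defs)
    finally show ?thesis by simp
  qed
  then have "(\<Sum>i\<in>UNIV. 3/4 * p * \<bar>ds $ Inl i\<bar>) \<le> (\<Sum>i\<in>UNIV. \<bar>d $ Inl i\<bar> + s $ Inl i * (kappa A * X))"
    by (intro sum_mono)
  then have B: "3/4 * (p * S) \<le> (\<Sum>i\<in>UNIV. \<bar>d $ Inl i\<bar>) + (\<Sum>i\<in>UNIV. s $ Inl i) * (kappa A * X)"
    by (simp add: defs sum.distrib sum_distrib_left[symmetric] sum_distrib_right[symmetric] mult.assoc del: times_divide_eq_left)
  have "3/4 * q * \<bar>dx $ Inr l\<bar> \<le> \<bar>d $ Inr l\<bar> + x $ Inr l * (kappa A * S)" for l
  proof -
    have "3/4 * q * \<bar>dx $ Inr l\<bar> \<le> \<bar>s $ Inr l * dx $ Inr l\<bar>"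
      unfolding abs_mult using large(2)[of l] by (intro mult_right_mono) auto
    also have "\<dots> \<le> \<bar>d $ Inr l\<bar> + \<bar>x $ Inr l * ds $ Inr l\<bar>"
      using dj[of "Inr l"] by linarith
    also have "\<bar>x $ Inr l * ds $ Inr l\<bar> \<le> x $ Inr l * (kappa A * S)"
      using pos(1)[of "Inr l"] tangent_bounds(2)[OF inv t, of l]
      by (simp add: abs_mult defs)
    finally show ?thesis by simp
  qed
  then have "(\<Sum>l\<in>UNIV. 3/4 * q * \<bar>dx $ Inr l\<bar>) \<le> (\<Sum>l\<in>UNIV. \<bar>d $ Inr l\<bar> + x $ Inr l * (kappa A * S))"
    by (intro sum_mono)
  then have N: "3/4 * (q * X) \<le> (\<Sum>l\<in>UNIV. \<bar>d $ Inr l\<bar>) + (\<Sum>l\<in>UNIV. x $ Inr l) * (kappa A * S)"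
    by (simp add: defs sum.distrib sum_distrib_left[symmetric] sum_distrib_right[symmetric] mult.assoc del: times_divide_eq_left)
  have "(\<Sum>i\<in>UNIV. s $ Inl i) * (kappa A * X) \<le> q * X / 4"
  proof -
    have "p * (\<Sum>i\<in>UNIV. s $ Inl i) * (kappa A * X) \<le> f * (kappa A * X)"
      using small(1) k nn by (intro mult_right_mono) auto
    also have "\<dots> \<le> p * (q * X / 4)"
      using mult_right_mono[OF kf nn(1)] by (simp add: algebra_simps)
    finally show ?thesis using pq by (simp add: mult.assoc)
  qed
  moreover have "(\<Sum>l\<in>UNIV. x $ Inr l) * (kappa A * S) \<le> p * S / 4"
  proof -
    have "q * (\<Sum>l\<in>UNIV. x $ Inr l) * (kappa A * S) \<le> f * (kappa A * S)"
      using small(2) k nn by (intro mult_right_mono) auto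
    also have "\<dots> \<le> q * (p * S / 4)"
      using mult_right_mono[OF kf nn(2)] by (simp add: algebra_simps)
    finally show ?thesis using pq by (simp add: mult.assoc)
  qed
  ultimately show ?thesis
    using B N unfolding small_part_size_def sum_UNIV_Plus defs[symmetric] by argo
qed

text \<open>
  The difference to the optimal pair is tangent, so orthogonality turns the duality gap into
  \<open>\<langle>s, x\<rangle> = \<langle>s, x\<^sup>*\<rangle> + \<langle>s\<^sup>*, x\<rangle>\<close>.
\<close>

lemma near_vertex:
  fixes A :: "real ^ ('m::finite + 'k::finite) ^ 'm"
  assumes inv: "invertible (basic_block A)"
    and xs: "A *v xs = b" "\<And>l. xs $ Inr l = 0" "\<And>i. p \<le> xs $ Inl i"
    and ss: "\<And>l. q \<le> s_star A c $ Inr l"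
    and pq: "0 < p" "0 < q"
    and feas: "(x, s, y) \<in> strictly_feasible A b c"
    and gap: "s \<bullet> x \<le> f" and kf: "kappa A * f \<le> p * q / 4"
  shows "3/4 * p \<le> x $ Inl i" "3/4 * q \<le> s $ Inr l"
    "p * (\<Sum>i\<in>UNIV. s $ Inl i) \<le> f" "q * (\<Sum>l\<in>UNIV. x $ Inr l) \<le> f"
proof -
  let ?ss = "s_star A c" and ?ys = "y_star A c"
  have pos: "0 < x $ j" "0 < s $ j" for j
    using feas by (auto simp: strictly_feasible_def)
  have Ax: "A *v x = b" and As: "s + transpose A *v y = c"
    using feas by (auto simp: strictly_feasible_def)
  have k: "0 \<le> kappa A" by (rule kappa_nonneg)
  have "transpose (basic_block A) *v ?ys = basic_part c"
  proof -
    let ?B = "transpose (basic_block A)"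
    have "invertible ?B" using inv by (rule transpose_invertible)
    from someI_ex[OF this[unfolded invertible_def]]
    have "?B ** matrix_inv ?B = mat 1" by (auto simp: matrix_inv_def)
    then show ?thesis
      unfolding y_star_def by (simp only: matrix_vector_mul_assoc matrix_vector_mul_lid)
  qed
  then have dual: "?ss + transpose A *v ?ys = c"
    by (auto simp: vec_eq_iff s_star_def basic_part_def nonbasic_part_def basic_block_def
        nonbasic_block_def matrix_vector_mult_def transpose_def split: sum.splits)
  have t: "tangent A (x - xs) (s - ?ss)"
    unfolding tangent_def
  proof (intro conjI exI)
    show "A *v (x - xs) = 0" by (simp add: matrix_vector_mult_diff_distrib Ax xs(1))
    show "s - ?ss + transpose A *v (y - ?ys) = 0"
      using As dual by (simp add: matrix_vector_mult_diff_distrib algebra_simps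
          del: transpose_matrix_vector)
  qed
  have sB: "?ss $ Inl i = 0" for i by (simp add: s_star_def)
  have "(\<Sum>j\<in>UNIV. (x - xs) $ j * (s - ?ss) $ j) = 0"
    using tangent_orthogonal[OF t t] .
  then have "(\<Sum>i\<in>UNIV. xs $ Inl i * s $ Inl i) + (\<Sum>l\<in>UNIV. ?ss $ Inr l * x $ Inr l) = s \<bullet> x"
    by (simp add: sum_UNIV_Plus inner_vec_def sB xs(2) algebra_simps sum.distrib sum_subtractf)
  moreover have "p * (\<Sum>i\<in>UNIV. s $ Inl i) \<le> (\<Sum>i\<in>UNIV. xs $ Inl i * s $ Inl i)"
    unfolding sum_distrib_left by (intro sum_mono mult_right_mono xs) (simp add: pos less_imp_le)
  moreover have "q * (\<Sum>l\<in>UNIV. x $ Inr l) \<le> (\<Sum>l\<in>UNIV. ?ss $ Inr l * x $ Inr l)"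
    unfolding sum_distrib_left by (intro sum_mono mult_right_mono ss) (simp add: pos less_imp_le)
  moreover have "0 \<le> p * (\<Sum>i\<in>UNIV. s $ Inl i)" "0 \<le> q * (\<Sum>l\<in>UNIV. x $ Inr l)"
    using pq pos by (auto intro!: mult_nonneg_nonneg sum_nonneg simp: less_imp_le)
  ultimately show pS: "p * (\<Sum>i\<in>UNIV. s $ Inl i) \<le> f" and qX: "q * (\<Sum>l\<in>UNIV. x $ Inr l) \<le> f"
    using gap by linarith+
  have "kappa A * (\<Sum>l\<in>UNIV. x $ Inr l) \<le> p / 4"
  proof -
    have "q * (kappa A * (\<Sum>l\<in>UNIV. x $ Inr l)) \<le> kappa A * f"
      using mult_left_mono[OF qX k] by (simp add: algebra_simps)
    then have "q * (kappa A * (\<Sum>l\<in>UNIV. x $ Inr l)) \<le> q * (p / 4)" using kf by (simp add: mult.commute)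
    then show ?thesis using pq by (simp only: mult_le_cancel_left_pos)
  qed
  moreover have "\<bar>x $ Inl i - xs $ Inl i\<bar> \<le> kappa A * (\<Sum>l\<in>UNIV. x $ Inr l)"
    using tangent_bounds(1)[OF inv t, of i] by (simp add: xs(2) pos abs_of_pos)
  ultimately show "3/4 * p \<le> x $ Inl i" using xs(3)[of i] by linarith
  have "kappa A * (\<Sum>i\<in>UNIV. s $ Inl i) \<le> q / 4"
  proof -
    have "p * (kappa A * (\<Sum>i\<in>UNIV. s $ Inl i)) \<le> kappa A * f"
      using mult_left_mono[OF pS k] by (simp add: algebra_simps)
    then have "p * (kappa A * (\<Sum>i\<in>UNIV. s $ Inl i)) \<le> p * (q / 4)" using kf by (simp add: mult.commute)
    then show ?thesis using pq by (simp only: mult_le_cancel_left_pos)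
  qed
  moreover have "\<bar>s $ Inr l - ?ss $ Inr l\<bar> \<le> kappa A * (\<Sum>i\<in>UNIV. s $ Inl i)"
    using tangent_bounds(2)[OF inv t, of l] by (simp add: sB pos abs_of_pos)
  ultimately show "3/4 * q \<le> s $ Inr l" using ss[of l] by linarith
qed

section \<open>Perturbation of a nearly central point\<close>

lemma omega_star_ge: assumes "0 \<le> r" "r < 1" shows "r\<^sup>2 / 2 \<le> omega_star r"
proof -
  let ?g = "\<lambda>t::real. - t - ln (1 - t) - t\<^sup>2 / 2"
  have "?g 0 \<le> ?g r"
  proof (rule DERIV_nonneg_imp_nondecreasing[OF assms(1)])
    fix t :: real assume t: "0 \<le> t" "t \<le> r"
    have "(?g has_real_derivative (1 / (1 - t) - 1 - t)) (at t)"
      using t assms by (auto intro!: derivative_eq_intros)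
    moreover have "1 / (1 - t) - 1 - t = t\<^sup>2 / (1 - t)"
      using t assms by (simp add: field_simps power2_eq_square)
    moreover have "0 \<le> t\<^sup>2 / (1 - t)" using t assms by simp
    ultimately show "\<exists>y. (?g has_real_derivative y) (at t) \<and> 0 \<le> y"
      by auto
  qed
  then show ?thesis by (simp add: omega_star_def)
qed

lemma member_le_L2_norm:
  fixes g :: "'j \<Rightarrow> real"
  shows "finite J \<Longrightarrow> j \<in> J \<Longrightarrow> \<bar>g j\<bar> \<le> sqrt (\<Sum>i\<in>J. (g i)\<^sup>2)"
  using member_le_sum[of j J "\<lambda>i. (g i)\<^sup>2"] by (simp add: real_le_rsqrt)

text \<open>
  Here \<open>t\<close> are the residuals divided by their mean.  With \<open>p = 1 / t - 1\<close>, the numbers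
  \<open>\<chi>\<^sub>2 = \<parallel>p\<parallel>\<close> and \<open>\<chi>\<^sub>1\<^sup>2 = \<Sum>p\<^sub>j = \<Sum>p\<^sub>j\<^sup>2 / (1 + p\<^sub>j)\<close> satisfy
  \<open>\<chi>\<^sub>2\<^sup>2 / (1 + \<chi>\<^sub>2) \<le> \<chi>\<^sub>1\<^sup>2\<close>, so that \<open>\<delta> \<le> r / (2 + r)\<close> yields
  \<open>\<chi>\<^sub>2 \<le> r / 2\<close> and \<open>\<chi>\<^sub>1\<^sup>2 \<le> r\<^sup>2 / 4\<close>.
\<close>

lemma barrier_perturbation:
  fixes t h :: "'j \<Rightarrow> real" and J :: "'j set"
  assumes J: "finite J" and t: "\<And>j. j \<in> J \<Longrightarrow> 0 < t j"
    and sum_t: "(\<Sum>j\<in>J. t j - 1) = 0"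
    and r: "0 < r" "r < 1"
    and center: "(\<Sum>j\<in>J. (t j - 1)\<^sup>2 / t j) \<le> r / (2 + r) * sqrt (\<Sum>j\<in>J. (t j - 1)\<^sup>2 / (t j)\<^sup>2)"
    and sum_h: "(\<Sum>j\<in>J. h j) = 0" and h: "(\<Sum>j\<in>J. \<bar>h j\<bar>) \<le> r / 5"
  shows "\<And>j. j \<in> J \<Longrightarrow> 0 < t j + h j" and "- (\<Sum>j\<in>J. ln (t j + h j)) < r\<^sup>2 / 2"
proof -
  define p where "p j = 1 / t j - 1" for j
  define N where "N = sqrt (\<Sum>j\<in>J. (p j)\<^sup>2)"
  have N0: "0 \<le> N" by (simp add: N_def sum_nonneg)
  have p1: "1 + p j = 1 / t j" for j by (simp add: p_def)
  have p1pos: "0 < 1 + p j" if "j \<in> J" for j using t[OF that] by (simp add: p1)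
  have pN: "\<bar>p j\<bar> \<le> N" if "j \<in> J" for j
    unfolding N_def using member_le_L2_norm[OF J that] .
  have e1: "(t j - 1)\<^sup>2 / (t j)\<^sup>2 = (p j)\<^sup>2" if "j \<in> J" for j
    using t[OF that] by (simp add: p_def field_simps power2_eq_square)
  have e3: "(t j - 1)\<^sup>2 / t j = p j + (t j - 1)" if "j \<in> J" for j
    using t[OF that] by (simp add: p_def field_simps power2_eq_square)
  have e2: "(t j - 1)\<^sup>2 / t j = (p j)\<^sup>2 / (1 + p j)" if "j \<in> J" for j
    using t[OF that] unfolding p1 e1[OF that, symmetric] by (simp add: power2_eq_square)
  have sum_p: "(\<Sum>j\<in>J. (t j - 1)\<^sup>2 / t j) = (\<Sum>j\<in>J. p j)"
    using sum_t by (simp add: e3 sum.distrib)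
  have N_eq: "sqrt (\<Sum>j\<in>J. (t j - 1)\<^sup>2 / (t j)\<^sup>2) = N"
    unfolding N_def by (simp add: e1)
  have center': "(\<Sum>j\<in>J. p j) \<le> r / (2 + r) * N"
    using center unfolding sum_p N_eq .
  have "N\<^sup>2 / (1 + N) = (\<Sum>j\<in>J. (p j)\<^sup>2 / (1 + N))"
    by (simp add: N_def sum_nonneg sum_divide_distrib)
  also have "\<dots> \<le> (\<Sum>j\<in>J. (p j)\<^sup>2 / (1 + p j))"
  proof (intro sum_mono divide_left_mono)
    fix j assume j: "j \<in> J"
    show "1 + p j \<le> 1 + N" using pN[OF j] by simp
    show "0 < (1 + N) * (1 + p j)" using p1pos[OF j] N0 by simp
  qed simp
  also have "\<dots> = (\<Sum>j\<in>J. p j)" unfolding sum_p[symmetric] by (simp add: e2)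
  finally have "N\<^sup>2 / (1 + N) \<le> r / (2 + r) * N" using center' by simp
  then have "N * (N * (2 + r)) \<le> N * (r * (1 + N))"
    using r N0 by (simp add: field_simps power2_eq_square)
  then have N_le: "N \<le> r / 2"
    using r N0 by (cases "N = 0") (auto simp: algebra_simps)
  have p_sum: "(\<Sum>j\<in>J. p j) \<le> r\<^sup>2 / 4"
  proof -
    have "r / (2 + r) * N \<le> r / 2 * (r / 2)"
      using r N0 N_le by (intro mult_mono frac_le) auto
    also have "\<dots> = r\<^sup>2 / 4" by (simp add: power2_eq_square)
    finally show ?thesis using center' by linarith
  qed
  \<comment> \<open>The relative perturbation: \<open>t + h = t (1 + g)\<close> with \<open>t = 1 / (1 + p)\<close>.\<close>
  define g where "g j = h j * (1 + p j)" for j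
  have th: "t j + h j = t j * (1 + g j)" if "j \<in> J" for j
    using t[OF that] by (simp add: g_def p1 field_simps)
  have g_abs: "\<bar>g j\<bar> \<le> 3/2 * \<bar>h j\<bar>" if "j \<in> J" for j
  proof -
    have "\<bar>1 + p j\<bar> \<le> 3/2" using pN[OF that] N_le r by linarith
    then show ?thesis unfolding g_def abs_mult
      using mult_left_mono[of "\<bar>1 + p j\<bar>" "3/2" "\<bar>h j\<bar>"] by (simp add: mult.commute)
  qed
  have h_le: "\<bar>h j\<bar> \<le> r / 5" if "j \<in> J" for j
    using member_le_sum[of j J "\<lambda>j. \<bar>h j\<bar>"] J that h by simp
  have g_le: "\<bar>g j\<bar> \<le> 3/10 * r" if "j \<in> J" for j
    using g_abs[OF that] h_le[OF that] by linarith
  have g1: "7/10 \<le> 1 + g j" if "j \<in> J" for j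
    using g_le[OF that] r by linarith
  show pos: "0 < t j + h j" if "j \<in> J" for j
    using th[OF that] g1[OF that] t[OF that] by simp
  have ln_bound: "- ln (t j + h j) \<le> p j - h j - h j * p j + 9/14 * r * \<bar>h j\<bar>" if j: "j \<in> J" for j
  proof -
    have "- ln (t j + h j) = ln (1 + p j) - ln (1 + g j)"
      using t[OF j] g1[OF j] by (simp add: th[OF j] p1 ln_mult ln_div)
    moreover have "ln (1 + p j) \<le> p j"
      using ln_le_minus_one[OF p1pos[OF j]] by simp
    moreover have "- ln (1 + g j) \<le> - g j + (g j)\<^sup>2 / (1 + g j)"
    proof -
      have "- ln (1 + g j) = ln (1 / (1 + g j))" using g1[OF j] by (simp add: ln_div)
      also have "\<dots> \<le> 1 / (1 + g j) - 1" using g1[OF j] by (intro ln_le_minus_one) simp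
      also have "\<dots> = - g j + (g j)\<^sup>2 / (1 + g j)"
        using g1[OF j] by (simp add: field_simps power2_eq_square)
      finally show ?thesis .
    qed
    moreover have "(g j)\<^sup>2 / (1 + g j) \<le> 9/14 * r * \<bar>h j\<bar>"
    proof -
      have "(g j)\<^sup>2 = \<bar>g j\<bar> * \<bar>g j\<bar>" by (simp add: power2_eq_square)
      also have "\<dots> \<le> 3/10 * r * (3/2 * \<bar>h j\<bar>)"
        using g_le[OF j] g_abs[OF j] r by (intro mult_mono) auto
      finally have "(g j)\<^sup>2 \<le> 9/20 * (r * \<bar>h j\<bar>)" by simp
      then have "(g j)\<^sup>2 / (1 + g j) \<le> 9/20 * (r * \<bar>h j\<bar>) / (7/10)"
        using g1[OF j] r by (intro frac_le) auto
      then show ?thesis by simp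
    qed
    ultimately show ?thesis by (simp add: g_def algebra_simps)
  qed
  have hp: "- (h j * p j) \<le> r / 2 * \<bar>h j\<bar>" if "j \<in> J" for j
  proof -
    have "- (h j * p j) \<le> \<bar>h j\<bar> * \<bar>p j\<bar>" by (metis abs_ge_minus_self abs_mult)
    also have "\<dots> \<le> \<bar>h j\<bar> * (r / 2)"
      using pN[OF that] N_le by (intro mult_left_mono) auto
    finally show ?thesis by (simp add: mult.commute)
  qed
  have "- (\<Sum>j\<in>J. ln (t j + h j)) \<le> (\<Sum>j\<in>J. p j - h j + (r / 2 + 9/14 * r) * \<bar>h j\<bar>)"
    unfolding sum_negf[symmetric]
  proof (rule sum_mono)
    fix j assume "j \<in> J"
    then show "- ln (t j + h j) \<le> p j - h j + (r / 2 + 9/14 * r) * \<bar>h j\<bar>"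
      using ln_bound[of j] hp[of j] by (simp add: algebra_simps)
  qed
  also have "\<dots> = (\<Sum>j\<in>J. p j) + 8/7 * r * (\<Sum>j\<in>J. \<bar>h j\<bar>)"
    unfolding sum.distrib sum_subtractf sum_h sum_distrib_left[symmetric] by simp
  also have "\<dots> \<le> r\<^sup>2 / 4 + 8/7 * r * (r / 5)"
    using p_sum h r by (intro add_mono mult_left_mono) auto
  also have "\<dots> < r\<^sup>2 / 2" using r by (simp add: power2_eq_square)
  finally show "- (\<Sum>j\<in>J. ln (t j + h j)) < r\<^sup>2 / 2" .
qed

lemma ln_shrink_towards_one:
  fixes a l :: real
  assumes "0 < a" "0 \<le> l" "l \<le> 1"
  shows "0 < 1 + l * (a - 1)" and "l * ln a \<le> ln (1 + l * (a - 1))"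
proof -
  have eq: "1 + l * (a - 1) = (1 - l) *\<^sub>R 1 + l *\<^sub>R a" by (simp add: algebra_simps)
  show "l * ln a \<le> ln (1 + l * (a - 1))"
    unfolding eq using concave_onD[OF ln_concave, of l 1 a] assms by simp
  show "0 < 1 + l * (a - 1)"
  proof (cases "l = 0")
    case False
    then have "0 < l * a" using assms by simp
    then show ?thesis unfolding eq using assms by simp
  qed simp
qed

text \<open>With \<open>2 \<kappa> \<le> 1 + \<kappa>\<^sup>2\<close> this absorbs the constant of the error bound, since \<open>241 \<le> 2 \<cdot> 121\<close>.\<close>

lemma c3_ge: "121 \<le> c3 r"
proof -
  have c: "11 \<le> (c1 r)\<^sup>2" by (simp add: c1_def)
  have c': "3 \<le> c1 r" unfolding c1_def by (rule real_le_rsqrt) (simp add: add_increasing2)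
  have s: "sqrt 2 \<le> 10/7" by (rule real_le_lsqrt) (auto simp: power2_eq_square)
  have "11 / (10/7) \<le> (c1 r)\<^sup>2 / sqrt 2" using c s by (intro frac_le) auto
  then have D: "77/10 \<le> (c1 r)\<^sup>2 / sqrt 2" by simp
  have "121 \<le> (1 + 77/10) * (1 + 2 * 3 + 77/10 :: real)" by simp
  also have "\<dots> \<le> c3 r"
    unfolding c3_def using D c' by (intro mult_mono add_mono) auto
  finally show ?thesis .
qed

section \<open>One predictor step\<close>

lemma sum_UNIV_option: "(\<Sum>j\<in>UNIV. g j) = g None + (\<Sum>i\<in>UNIV. g (Some (i :: 'n::finite)))"
  by (simp add: UNIV_option_conv sum.reindex)

lemma norm_vec_power2: "(norm (v :: real ^ 'n::finite))\<^sup>2 = (\<Sum>i\<in>UNIV. (v $ i)\<^sup>2)"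
  unfolding power2_norm_eq_inner inner_vec_def by (simp add: power2_eq_square)

lemma residual_None: "residual ((x, s, y), (v0, v)) $ None = v0 - (\<Sum>i\<in>UNIV. x $ i * s $ i)"
  by (simp add: residual_def inner_vec_def mult.commute)

lemma residual_Some: "residual ((x, s, y), (v0, v)) $ Some i = x $ i * s $ i - (v $ i)\<^sup>2"
  by (simp add: residual_def)

lemma sum_residual:
  fixes z :: "('n::finite, 'm) state"
  shows "(\<Sum>j\<in>UNIV. residual z $ j) = (real CARD('n) + 1) * rho (snd z)"
proof -
  obtain x s y v0 v where z: "z = ((x, s, y), (v0, v))" by (metis surj_pair)
  have "0 < real CARD('n) + 1" by simp
  then show ?thesis
    unfolding z sum_UNIV_option residual_None residual_Some
    by (simp add: rho_def norm_vec_power2 sum_subtractf)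
qed

lemma predictor_test_center:
  fixes z :: "('n::finite, 'm) state"
  assumes res: "\<And>j. 0 < residual z $ j" and rho: "0 < rho (snd z)"
    and test: "predictor_test r z" and t: "\<And>j. t j = residual z $ j / rho (snd z)"
  shows "(\<Sum>j\<in>UNIV. (t j - 1)\<^sup>2 / t j) \<le> r / (2 + r) * sqrt (\<Sum>j\<in>UNIV. (t j - 1)\<^sup>2 / (t j)\<^sup>2)"
proof -
  let ?R = "rho (snd z)"
  have tpos: "0 < t j" for j using res rho by (simp add: t)
  have "(residual z $ j - ?R)\<^sup>2 / (residual z $ j ^ 2 * ?R ^ (2 - 2)) = (t j - 1)\<^sup>2 / (t j)\<^sup>2" for j
    using res[of j] rho by (simp add: t field_simps power2_eq_square)
  then have p2: "prox 2 z = sqrt (\<Sum>j\<in>UNIV. (t j - 1)\<^sup>2 / (t j)\<^sup>2)"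
    unfolding prox_def by simp
  have "(residual z $ j - ?R)\<^sup>2 / (residual z $ j ^ 1 * ?R ^ (2 - 1)) = (t j - 1)\<^sup>2 / t j" for j
    using res[of j] rho by (simp add: t field_simps power2_eq_square)
  then have "prox 1 z = sqrt (\<Sum>j\<in>UNIV. (t j - 1)\<^sup>2 / t j)"
    unfolding prox_def by simp
  then have p1: "(prox 1 z)\<^sup>2 = (\<Sum>j\<in>UNIV. (t j - 1)\<^sup>2 / t j)"
    using tpos by (simp add: sum_nonneg less_imp_le)
  show ?thesis
  proof (cases "prox 2 z = 0")
    case True
    then have "(\<Sum>j\<in>UNIV. (t j - 1)\<^sup>2 / (t j)\<^sup>2) = 0" by (simp add: p2)
    then have zero: "(t j - 1)\<^sup>2 / (t j)\<^sup>2 = 0" for j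
      by (subst (asm) sum_nonneg_eq_0_iff) auto
    have "t j = 1" for j using zero[of j] tpos[of j] by simp
    then show ?thesis by simp
  next
    case False
    then have "0 < prox 2 z" by (simp add: p2 sum_nonneg less_le)
    then show ?thesis
      using test unfolding predictor_test_def prox_delta_def
      by (simp add: p1[symmetric] p2[symmetric] pos_divide_le_eq)
  qed
qed

text \<open>
  The term \<open>\<mu>\<close> pulls the normalised residuals towards one; by concavity of the logarithm this
  only helps, and only the error \<open>e\<close> has to be compared with \<open>\<rho>\<close>.
\<close>

lemma Psi_after_predictor:
  fixes z z' :: "('n::finite, 'm) state" and e :: "'n option \<Rightarrow> real"
  assumes res: "\<And>j. 0 < residual z $ j" and rho: "0 < rho (snd z)"
    and r: "0 < r" "r < 1" and test: "predictor_test r z"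
    and T: "0 < T" and \<mu>: "0 \<le> \<mu>"
    and res': "\<And>j. residual z' $ j = T * (residual z $ j + \<mu>) + e j"
    and rho': "rho (snd z') = T * (rho (snd z) + \<mu>)"
    and e: "(\<Sum>j\<in>UNIV. e j) = 0" "(\<Sum>j\<in>UNIV. \<bar>e j\<bar>) \<le> T * rho (snd z) * (r / 5)"
  shows "Psi z' < r\<^sup>2 / 2"
proof -
  define R where "R = rho (snd z)"
  define t where "t j = residual z $ j / R" for j
  define h where "h j = e j / (T * R)" for j
  define l where "l = R / (R + \<mu>)"
  let ?G = "- (\<Sum>j\<in>UNIV. ln (t j + h j))"
  have R: "0 < R" using rho by (simp add: R_def)
  have l: "0 \<le> l" "l \<le> 1" using R \<mu> by (auto simp: l_def)
  have tpos: "0 < t j" for j using res R by (simp add: t_def)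
  have sum_t: "(\<Sum>j\<in>UNIV. t j - 1) = 0"
    using R by (simp add: t_def sum_subtractf sum_residual R_def flip: sum_divide_distrib)
  have sum_h: "(\<Sum>j\<in>UNIV. h j) = 0"
    by (simp add: h_def e flip: sum_divide_distrib)
  have abs_h: "(\<Sum>j\<in>UNIV. \<bar>h j\<bar>) \<le> r / 5"
  proof -
    have "(\<Sum>j\<in>UNIV. \<bar>h j\<bar>) = (\<Sum>j\<in>UNIV. \<bar>e j\<bar>) / (T * R)"
      using T R by (simp add: h_def abs_mult flip: sum_divide_distrib)
    also have "\<dots> \<le> T * R * (r / 5) / (T * R)"
      using e(2) T R by (intro divide_right_mono) (auto simp: R_def)
    finally show ?thesis using T R by simp
  qed
  note center = predictor_test_center[OF res rho test, of t, OF t_def[unfolded R_def]]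
  note bp = barrier_perturbation[OF finite_class.finite_UNIV tpos sum_t r center sum_h abs_h]
  have R': "0 < rho (snd z')" using T R \<mu> by (simp add: rho' R_def[symmetric])
  have ln_bound: "ln (rho (snd z')) + l * ln (t j + h j) \<le> ln (residual z' $ j)" for j
  proof -
    have th: "0 < t j + h j" using bp(1)[of j] by simp
    have eq: "residual z' $ j = rho (snd z') * (1 + l * (t j + h j - 1))"
      using T R \<mu> unfolding res' rho' R_def[symmetric] l_def t_def h_def
      by (simp add: divide_simps) (simp add: algebra_simps)
    show ?thesis
      using ln_shrink_towards_one[OF th l] R' by (simp add: eq ln_mult)
  qed
  have "(\<Sum>j\<in>UNIV. ln (rho (snd z')) + l * ln (t j + h j)) \<le> (\<Sum>j\<in>UNIV. ln (residual z' $ j))"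
    by (intro sum_mono ln_bound)
  then have "Psi z' \<le> l * ?G"
    by (simp add: Psi_def barrier_def sum.distrib algebra_simps flip: sum_distrib_left)
  also have "\<dots> < r\<^sup>2 / 2"
  proof (cases "?G \<le> 0")
    case True
    then have "l * ?G \<le> 0" using l by (simp add: mult_nonneg_nonpos)
    also have "0 < r\<^sup>2 / 2" using r by simp
    finally show ?thesis .
  next
    case False
    then have "l * ?G \<le> ?G" using l by (intro mult_left_le_one_le) auto
    also have "\<dots> < r\<^sup>2 / 2" using bp(2) .
    finally show ?thesis .
  qed
  finally show ?thesis .
qed

text \<open>
  The orders \<open>\<alpha>\<close> and \<open>\<alpha>\<^sup>2\<close> of \<open>x' s'\<close> are prescribed by the right-hand sides of the two Newton
  systems; the rest is \<open>e\<close>, and its entries sum to zero because tangent directions are orthogonal.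
\<close>

lemma predictor_residual:
  fixes x s v :: "real ^ 'n::finite" and A :: "real ^ 'n ^ 'm::finite"
  assumes t: "tangent A dx ds" "tangent A dx' ds'"
    and \<mu>: "\<mu> = (norm v)\<^sup>2 / (real CARD('n) + 1)"
    and D: "x * ds + s * dx = \<mu> *\<^sub>R 1 - v\<^sup>2 - x * s"
    and D': "x * ds' + s * dx' = v\<^sup>2 - \<mu> *\<^sub>R 1 - dx * ds"
    and z: "z = ((x, s, y), (v0, v))"
    and z': "z' = ((x + \<alpha> *\<^sub>R dx + \<alpha>\<^sup>2 *\<^sub>R dx', s + \<alpha> *\<^sub>R ds + \<alpha>\<^sup>2 *\<^sub>R ds', y'),
      (1 - \<alpha>) *\<^sub>R (v0, v))"
    and e: "\<And>i. e (Some i) = \<alpha> ^ 3 * (dx $ i * ds' $ i + dx' $ i * ds $ i) + \<alpha> ^ 4 * (dx' $ i * ds' $ i)"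
      "e None = 0"
  shows "residual z' $ j = (1 - \<alpha>) * (residual z $ j + \<alpha> * \<mu>) + e j"
    and "rho (snd z') = (1 - \<alpha>) * (rho (snd z) + \<alpha> * \<mu>)"
    and "(\<Sum>j\<in>UNIV. e j) = 0"
proof -
  let ?n = "real CARD('n)"
  show sum_e: "(\<Sum>j\<in>UNIV. e j) = 0"
    unfolding sum_UNIV_option e
    by (simp add: sum.distrib tangent_orthogonal[OF t(1,2)] tangent_orthogonal[OF t(2,1)]
        tangent_orthogonal[OF t(2,2)] flip: sum_distrib_left)
  show rho': "rho (snd z') = (1 - \<alpha>) * (rho (snd z) + \<alpha> * \<mu>)"
  proof -
    define m where "m = ?n + 1"
    have m: "0 < m" by (simp add: m_def)
    have "(norm ((1 - \<alpha>) *\<^sub>R v))\<^sup>2 = (1 - \<alpha>)\<^sup>2 * (norm v)\<^sup>2"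
      by (simp add: power_mult_distrib)
    then show ?thesis
      using m unfolding z z' \<mu> m_def[symmetric]
      by (simp add: rho_def m_def[symmetric] del: norm_scaleR)
        (simp add: field_simps power2_eq_square)
  qed
  have S: "residual z' $ Some i = (1 - \<alpha>) * (residual z $ Some i + \<alpha> * \<mu>) + e (Some i)" for i
  proof -
    have d: "x $ i * ds $ i + s $ i * dx $ i = \<mu> - (v $ i)\<^sup>2 - x $ i * s $ i"
      using D by (simp add: vec_eq_iff power2_eq_square)
    have d': "x $ i * ds' $ i + s $ i * dx' $ i = (v $ i)\<^sup>2 - \<mu> - dx $ i * ds $ i"
      using D' by (simp add: vec_eq_iff power2_eq_square)
    have "residual z' $ Some i = x $ i * s $ i + \<alpha> * (x $ i * ds $ i + s $ i * dx $ i)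
        + \<alpha>\<^sup>2 * (x $ i * ds' $ i + s $ i * dx' $ i + dx $ i * ds $ i) + e (Some i)
        - ((1 - \<alpha>) * v $ i)\<^sup>2"
      unfolding z' e by (simp add: residual_Some) (simp add: algebra_simps power2_eq_square power3_eq_cube power4_eq_xxxx)
    also have "\<dots> = (1 - \<alpha>) * (residual z $ Some i + \<alpha> * \<mu>) + e (Some i)"
      unfolding d d' z by (simp add: residual_Some) (simp add: algebra_simps power2_eq_square)
    finally show ?thesis .
  qed
  \<comment> \<open>Component \<open>0\<close> follows from the others, as the residuals add up to \<open>(n + 1) \<rho>\<close>.\<close>
  have N: "residual z' $ None = (1 - \<alpha>) * (residual z $ None + \<alpha> * \<mu>)"
  proof -
    have "(\<Sum>j\<in>UNIV. residual z' $ j) = (\<Sum>j\<in>UNIV. (1 - \<alpha>) * (residual z $ j + \<alpha> * \<mu>) + e j)"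
      unfolding sum.distrib sum_e sum_distrib_left[symmetric] sum_residual rho'
      by (simp add: algebra_simps)
    then show ?thesis unfolding sum_UNIV_option S by (simp add: e(2))
  qed
  show "residual z' $ j = (1 - \<alpha>) * (residual z $ j + \<alpha> * \<mu>) + e j"
    by (cases j) (simp_all add: S N e(2))
qed

text \<open>
  The two directions have sizes at most \<open>6 f\<close> and \<open>13 f\<^sup>2 / f\<^sub>0\<close>; the constant \<open>241\<close> rounds up
  \<open>2 \<cdot> 6 \<cdot> 13 + 13\<^sup>2 / 2\<close>.  No lower bound on the products \<open>x\<^sup>(\<^sup>i\<^sup>) s\<^sup>(\<^sup>i\<^sup>)\<close> is needed,
  so the estimate does not deteriorate when \<open>\<rho>\<close> is small compared with \<open>\<mu>\<close>.
\<close>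

lemma predictor_error:
  fixes A :: "real ^ ('m::finite + 'k::finite) ^ 'm"
  assumes inv: "invertible (basic_block A)" and t: "tangent A dx ds" "tangent A dx' ds'"
    and \<mu>: "\<mu> = (norm v)\<^sup>2 / (real CARD('m + 'k) + 1)"
    and D: "x * ds + s * dx = \<mu> *\<^sub>R 1 - v\<^sup>2 - x * s"
    and D': "x * ds' + s * dx' = v\<^sup>2 - \<mu> *\<^sub>R 1 - dx * ds"
    and pq: "0 < p" "0 < q"
    and pos: "\<And>j. 0 < x $ j" "\<And>j. 0 < s $ j"
    and large: "\<And>i. 3/4 * p \<le> x $ Inl i" "\<And>l. 3/4 * q \<le> s $ Inr l"
    and small: "p * (\<Sum>i\<in>UNIV. s $ Inl i) \<le> f" "q * (\<Sum>l\<in>UNIV. x $ Inr l) \<le> f"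
    and gap: "s \<bullet> x \<le> f" and f: "0 < f" "f \<le> f0"
    and v: "(norm v)\<^sup>2 \<le> f\<^sup>2 / f0"
    and kf: "kappa A * f0 \<le> p * q / 4"
    and \<alpha>: "0 \<le> \<alpha>" "\<alpha> \<le> 1"
  shows "(\<Sum>j\<in>UNIV. \<bar>\<alpha> ^ 3 * (dx $ j * ds' $ j + dx' $ j * ds $ j) + \<alpha> ^ 4 * (dx' $ j * ds' $ j)\<bar>)
    \<le> 241 * kappa A * f ^ 3 / (f0 * (p * q))"
proof -
  let ?n = "real CARD('m + 'k)" and ?k = "kappa A"
  let ?N = "small_part_size p q dx ds" and ?N' = "small_part_size p q dx' ds'"
  have f0: "0 < f0" using f by simp
  have k: "0 \<le> ?k" by (rule kappa_nonneg)
  have N0: "0 \<le> ?N" "0 \<le> ?N'" using pq by (auto simp: small_part_size_def intro!: add_nonneg_nonneg mult_nonneg_nonneg sum_nonneg)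
  have "?k * f \<le> ?k * f0" using f k by (intro mult_left_mono) auto
  then have kf': "?k * f \<le> p * q / 4" using kf by linarith
  note size = direction_size[OF inv _ _ pq pos large small kf']
  have ff0: "f\<^sup>2 / f0 \<le> f"
    using f f0 by (simp add: power2_eq_square field_simps mult_left_mono)
  have \<mu>0: "0 \<le> \<mu>" by (simp add: \<mu>)
  have n\<mu>: "?n * \<mu> \<le> (norm v)\<^sup>2"
  proof -
    have "0 < ?n + 1" by simp
    then have "(?n + 1) * \<mu> = (norm v)\<^sup>2" by (simp add: \<mu>)
    then show ?thesis using \<mu>0 by (simp add: algebra_simps)
  qed
  have xs: "(\<Sum>j\<in>UNIV. x $ j * s $ j) \<le> f"
    using gap by (simp add: inner_vec_def mult.commute)
  have "(\<Sum>j\<in>UNIV. \<bar>(\<mu> *\<^sub>R 1 - v\<^sup>2 - x * s) $ j\<bar>) \<le> (\<Sum>j\<in>UNIV. \<mu> + (v $ j)\<^sup>2 + x $ j * s $ j)"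
  proof (rule sum_mono)
    fix j :: "'m + 'k"
    have "0 < x $ j * s $ j" using pos by simp
    moreover have "0 \<le> (v $ j)\<^sup>2" by simp
    moreover have "(\<mu> *\<^sub>R 1 - v\<^sup>2 - x * s) $ j = \<mu> - (v $ j)\<^sup>2 - x $ j * s $ j"
      by (simp add: power2_eq_square)
    ultimately show "\<bar>(\<mu> *\<^sub>R 1 - v\<^sup>2 - x * s) $ j\<bar> \<le> \<mu> + (v $ j)\<^sup>2 + x $ j * s $ j"
      using \<mu>0 by linarith
  qed
  also have "\<dots> = ?n * \<mu> + (norm v)\<^sup>2 + (\<Sum>j\<in>UNIV. x $ j * s $ j)"
    by (simp add: sum.distrib norm_vec_power2)
  also have "\<dots> \<le> 3 * f" using n\<mu> v ff0 xs by linarith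
  finally have N: "?N \<le> 6 * f" using size[OF t(1) D] by linarith
  have "?k / (2 * (p * q)) * ?N\<^sup>2 \<le> ?k / (2 * (p * q)) * (6 * f)\<^sup>2"
    using k pq N N0 by (intro mult_left_mono power_mono) auto
  also have "\<dots> = 18 * f\<^sup>2 / (p * q * f0) * (?k * f0)"
    using pq f0 by (simp add: field_simps power2_eq_square)
  also have "\<dots> \<le> 18 * f\<^sup>2 / (p * q * f0) * (p * q / 4)"
    using kf pq f0 by (intro mult_left_mono) auto
  also have "\<dots> = 9/2 * (f\<^sup>2 / f0)" using pq by (simp add: field_simps)
  finally have dd: "(\<Sum>j\<in>UNIV. \<bar>dx $ j * ds $ j\<bar>) \<le> 9/2 * (f\<^sup>2 / f0)"
    using tangent_products_le(2)[OF inv t(1) t(1) pq] by linarith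
  have "(\<Sum>j\<in>UNIV. \<bar>(v\<^sup>2 - \<mu> *\<^sub>R 1 - dx * ds) $ j\<bar>) \<le> (\<Sum>j\<in>UNIV. \<mu> + (v $ j)\<^sup>2 + \<bar>dx $ j * ds $ j\<bar>)"
  proof (rule sum_mono)
    fix j :: "'m + 'k"
    have "\<bar>(v $ j)\<^sup>2 - \<mu> - dx $ j * ds $ j\<bar> \<le> \<bar>(v $ j)\<^sup>2\<bar> + \<bar>\<mu>\<bar> + \<bar>dx $ j * ds $ j\<bar>" by linarith
    then show "\<bar>(v\<^sup>2 - \<mu> *\<^sub>R 1 - dx * ds) $ j\<bar> \<le> \<mu> + (v $ j)\<^sup>2 + \<bar>dx $ j * ds $ j\<bar>"
      using \<mu>0 by (simp add: power2_eq_square)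
  qed
  also have "\<dots> = ?n * \<mu> + (norm v)\<^sup>2 + (\<Sum>j\<in>UNIV. \<bar>dx $ j * ds $ j\<bar>)"
    by (simp add: sum.distrib norm_vec_power2)
  also have "\<dots> \<le> 13/2 * (f\<^sup>2 / f0)" using n\<mu> v dd by linarith
  finally have N': "?N' \<le> 13 * (f\<^sup>2 / f0)" using size[OF t(2) D'] by linarith
  have "(\<Sum>j\<in>UNIV. \<bar>\<alpha> ^ 3 * (dx $ j * ds' $ j + dx' $ j * ds $ j) + \<alpha> ^ 4 * (dx' $ j * ds' $ j)\<bar>)
      \<le> (\<Sum>j\<in>UNIV. \<bar>dx $ j * ds' $ j + dx' $ j * ds $ j\<bar> + \<bar>dx' $ j * ds' $ j\<bar>)"
  proof (rule sum_mono)
    fix j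
    have "\<bar>\<alpha> ^ m * a\<bar> \<le> \<bar>a\<bar>" for m and a :: real
      using \<alpha> by (simp add: abs_mult power_le_one mult_left_le_one_le)
    then show "\<bar>\<alpha> ^ 3 * (dx $ j * ds' $ j + dx' $ j * ds $ j) + \<alpha> ^ 4 * (dx' $ j * ds' $ j)\<bar>
        \<le> \<bar>dx $ j * ds' $ j + dx' $ j * ds $ j\<bar> + \<bar>dx' $ j * ds' $ j\<bar>"
      by (meson abs_triangle_ineq add_mono order_trans)
  qed
  also have "\<dots> \<le> 2 * ?k / (p * q) * (?N * ?N') + ?k / (2 * (p * q)) * ?N'\<^sup>2"
    unfolding sum.distrib
    by (intro add_mono tangent_products_le(1)[OF inv t pq] tangent_products_le(2)[OF inv t(2) t(2) pq])
  also have "\<dots> \<le> 2 * ?k / (p * q) * (6 * f * (13 * (f\<^sup>2 / f0)))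
      + ?k / (2 * (p * q)) * (13 * (f\<^sup>2 / f0) * (13 * f))"
  proof (intro add_mono mult_left_mono)
    show "?N * ?N' \<le> 6 * f * (13 * (f\<^sup>2 / f0))"
      using N N' N0 f by (intro mult_mono) auto
    have "?N'\<^sup>2 = ?N' * ?N'" by (simp add: power2_eq_square)
    also have "\<dots> \<le> 13 * (f\<^sup>2 / f0) * (13 * f)"
      using N' N0 f f0 ff0 by (intro mult_mono) auto
    finally show "?N'\<^sup>2 \<le> 13 * (f\<^sup>2 / f0) * (13 * f)" .
  qed (use k pq in auto)
  also have "\<dots> = 481/2 * (?k * f ^ 3 / (f0 * (p * q)))"
    using pq f0 by (simp add: field_simps power2_eq_square power3_eq_cube)
  also have "\<dots> \<le> 241 * (?k * f ^ 3 / (f0 * (p * q)))"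
    using k f f0 pq by (intro mult_right_mono) auto
  finally show ?thesis by simp
qed

lemma predictor_contraction:
  fixes A :: "real ^ ('m::finite + 'k::finite) ^ 'm"
  assumes inv: "invertible (basic_block A)"
    and xs: "A *v xs = b" "\<And>l. xs $ Inr l = 0" "\<And>i. p \<le> xs $ Inl i"
    and ss: "\<And>l. q \<le> s_star A c $ Inr l"
    and pq: "0 < p" "0 < q"
    and r: "0 < r" "r < 1"
    and z: "z \<in> interior_F A b c" and test: "predictor_test r z"
    and step: "predictor_step A b c r z z'"
    and f: "f = fst (snd z)" "f < f0"
    and v: "(norm (snd (snd z)))\<^sup>2 \<le> f\<^sup>2 / f0"
    and kf: "kappa A * f0 \<le> p * q / 4"
  shows "fst (snd z') \<le> 5 * (real CARD('m + 'k) + 1) * (1 + (kappa A)\<^sup>2) * c3 r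
    / (p * q * r * (f0 - f)) * f ^ 3"
proof -
  let ?n = "real CARD('m + 'k)" and ?k = "kappa A"
  obtain x s y v0 v where ze: "z = ((x, s, y), (v0, v))" by (metis surj_pair)
  have v0: "v0 = f" by (simp add: f(1) ze)
  define \<mu> where "\<mu> = (norm v)\<^sup>2 / (?n + 1)"
  obtain dx ds dy where D1: "direction A (x, s, y) (\<mu> *\<^sub>R 1 - v\<^sup>2 - x * s) = (dx, ds, dy)"
    by (metis surj_pair)
  obtain dx' ds' dy' where D2: "direction A (x, s, y) (v\<^sup>2 - \<mu> *\<^sub>R 1 - dx * ds) = (dx', ds', dy')"
    by (metis surj_pair)
  from step obtain \<alpha> where \<alpha>: "0 < \<alpha>" "\<alpha> < 1"
    and z': "z' = ((x, s, y) + \<alpha> *\<^sub>R (dx, ds, dy) + \<alpha>\<^sup>2 *\<^sub>R (dx', ds', dy'), (1 - \<alpha>) *\<^sub>R (v0, v))"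
    and psi: "Psi z' = omega_star r"
    unfolding predictor_step_def ze prod.case Let_def \<mu>_def[symmetric] D1 fst_conv snd_conv D2
    by blast
  have z'': "z' = ((x + \<alpha> *\<^sub>R dx + \<alpha>\<^sup>2 *\<^sub>R dx', s + \<alpha> *\<^sub>R ds + \<alpha>\<^sup>2 *\<^sub>R ds',
      y + \<alpha> *\<^sub>R dy + \<alpha>\<^sup>2 *\<^sub>R dy'), (1 - \<alpha>) *\<^sub>R (v0, v))"
    by (simp add: z')
  have feas: "(x, s, y) \<in> strictly_feasible A b c" and res: "0 < residual z $ j"
    and vf: "(norm v)\<^sup>2 < v0" for j
    using z by (auto simp: interior_F_def ze control_set_def)
  have pos: "0 < x $ j" "0 < s $ j" for j using feas by (auto simp: strictly_feasible_def)
  have gap: "s \<bullet> x \<le> f" using res[of None] by (simp add: ze residual_def v0)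
  have fpos: "0 < f" using vf v0 zero_le_power2[of "norm v"] by linarith
  have f0: "0 < f0" using fpos f(2) by simp
  have k: "0 \<le> ?k" by (rule kappa_nonneg)
  have nv: "(norm v)\<^sup>2 \<le> f\<^sup>2 / f0" using v by (simp add: ze)
  have "?k * f \<le> ?k * f0" using f(2) k by (intro mult_left_mono) auto
  then have kf': "?k * f \<le> p * q / 4" using kf by linarith
  note d1 = direction_eqs[OF inv pos D1] and d2 = direction_eqs[OF inv pos D2]
  note vertex = near_vertex[OF inv xs ss pq feas gap kf']
  define e where "e = (\<lambda>j. case j of None \<Rightarrow> 0
    | Some i \<Rightarrow> \<alpha> ^ 3 * (dx $ i * ds' $ i + dx' $ i * ds $ i) + \<alpha> ^ 4 * (dx' $ i * ds' $ i))"
  have e: "e (Some i) = \<alpha> ^ 3 * (dx $ i * ds' $ i + dx' $ i * ds $ i) + \<alpha> ^ 4 * (dx' $ i * ds' $ i)"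
    "e None = 0" for i by (simp_all add: e_def)
  note new = predictor_residual[OF d1(2) d2(2) \<mu>_def d1(1) d2(1) ze z'' e]
  define M where "M = 241 * ?k * f ^ 3 / (f0 * (p * q))"
  have M: "(\<Sum>j\<in>UNIV. \<bar>e j\<bar>) \<le> M"
    unfolding sum_UNIV_option e M_def
    using predictor_error[OF inv d1(2) d2(2) \<mu>_def d1(1) d2(1) pq pos vertex gap fpos _ nv kf, of \<alpha>]
      f(2) \<alpha> by simp
  define R where "R = rho (snd z)"
  have nR: "(?n + 1) * R = f - (norm v)\<^sup>2" 
  proof -
    have "0 < ?n + 1" by simp
    then show ?thesis by (simp add: R_def rho_def ze v0)
  qed
  have Rpos: "0 < R"
  proof -
    have "0 < (?n + 1) * R" unfolding nR using vf by (simp add: v0)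
    then show ?thesis by (simp add: zero_less_mult_iff)
  qed
  have \<mu>0: "0 \<le> \<alpha> * \<mu>" using \<alpha> by (simp add: \<mu>_def)
  \<comment> \<open>A smaller error would contradict the step size rule \<open>\<Psi> = \<omega>\<^sub>*(r)\<close>.\<close>
  have large: "\<not> M \<le> (1 - \<alpha>) * R * (r / 5)"
  proof
    assume "M \<le> (1 - \<alpha>) * R * (r / 5)"
    then have "Psi z' < r\<^sup>2 / 2"
      using Psi_after_predictor[OF res _ r test _ \<mu>0 new(1) new(2) new(3)] M Rpos \<alpha>
      unfolding R_def[symmetric] by simp
    then show False using omega_star_ge[of r] r psi by simp
  qed
  have fR: "f * (f0 - f) \<le> f0 * ((?n + 1) * R)"
    using nv f0 unfolding nR by (simp add: field_simps power2_eq_square)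
  have ineq: "242 * ?k \<le> (1 + ?k\<^sup>2) * c3 r"
  proof -
    have "0 \<le> (1 - ?k)\<^sup>2" by simp
    then have "2 * ?k \<le> 1 + ?k\<^sup>2" by (simp add: power2_eq_square algebra_simps)
    then have "2 * ?k * 121 \<le> (1 + ?k\<^sup>2) * c3 r" using c3_ge k by (intro mult_mono) auto
    then show ?thesis by simp
  qed
  have "(1 - \<alpha>) * (f * (f0 - f)) * r \<le> (1 - \<alpha>) * (f0 * ((?n + 1) * R)) * r"
    using fR \<alpha> r by (intro mult_right_mono mult_left_mono) auto
  also have "\<dots> = 5 * f0 * (?n + 1) * ((1 - \<alpha>) * R * (r / 5))" by simp
  also have "\<dots> \<le> 5 * f0 * (?n + 1) * M" using large f0 by (intro mult_left_mono) auto
  also have "\<dots> = 5 * (?n + 1) * (241 * ?k) * f ^ 3 / (p * q)"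
    using f0 pq by (simp add: M_def field_simps)
  also have "\<dots> \<le> 5 * (?n + 1) * ((1 + ?k\<^sup>2) * c3 r) * f ^ 3 / (p * q)"
    using ineq k pq fpos by (intro divide_right_mono mult_right_mono mult_left_mono) auto
  finally have "(1 - \<alpha>) * (f * (f0 - f)) * r \<le> 5 * (?n + 1) * ((1 + ?k\<^sup>2) * c3 r) * f ^ 3 / (p * q)" .
  then have "(1 - \<alpha>) * f * (r * (f0 - f)) \<le> 5 * (?n + 1) * ((1 + ?k\<^sup>2) * c3 r) * f ^ 3 / (p * q)"
    by (simp add: mult_ac)
  then have "(1 - \<alpha>) * f \<le> 5 * (?n + 1) * ((1 + ?k\<^sup>2) * c3 r) * f ^ 3 / (p * q) / (r * (f0 - f))"
    using r f(2) by (subst pos_le_divide_eq) auto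
  also have "\<dots> = 5 * (?n + 1) * (1 + ?k\<^sup>2) * c3 r / (p * q * r * (f0 - f)) * f ^ 3"
    by (simp add: mult_ac)
  finally show ?thesis by (simp add: z' v0)
qed

section \<open>The run of the method\<close>

lemma initial_state_properties:
  fixes u :: "('n::finite, 'm::finite) pd_point"
  assumes "u \<in> strictly_feasible A b c"
  shows "initial_state u \<in> interior_F A b c"
    and "(norm (snd (snd (initial_state u))))\<^sup>2 \<le> fst (snd (initial_state u))"
    and "0 < fst (snd (initial_state u))"
proof -
  obtain x s y where u: "u = (x, s, y)" by (metis surj_pair)
  have pos: "0 < x $ i" "0 < s $ i" for i using assms by (auto simp: u strictly_feasible_def)
  define \<sigma> where "\<sigma> = Min (range (\<lambda>i. x $ i * s $ i))"
  define v :: "real ^ 'n" where "v = (\<chi> i. sqrt (x $ i * s $ i - \<sigma>))"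
  have \<sigma>_le: "\<sigma> \<le> x $ i * s $ i" for i unfolding \<sigma>_def by (rule Min_le) auto
  have \<sigma>: "0 < \<sigma>" unfolding \<sigma>_def by (subst Min_gr_iff) (auto simp: pos)
  have i: "initial_state u = ((x, s, y), (s \<bullet> x + \<sigma>, v))"
    by (simp add: u initial_state_def Let_def \<sigma>_def v_def)
  have v2: "(v $ i)\<^sup>2 = x $ i * s $ i - \<sigma>" for i using \<sigma>_le[of i] by (simp add: v_def)
  have "(norm v)\<^sup>2 = s \<bullet> x - real CARD('n) * \<sigma>"
    by (simp add: norm_vec_power2 v2 sum_subtractf inner_vec_def mult.commute)
  moreover have "0 \<le> real CARD('n) * \<sigma>" using \<sigma> by simp
  ultimately have nv: "(norm v)\<^sup>2 < s \<bullet> x + \<sigma>" using \<sigma> by linarith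
  then show "(norm (snd (snd (initial_state u))))\<^sup>2 \<le> fst (snd (initial_state u))"
    by (simp add: i)
  have p: "0 < s \<bullet> x + \<sigma>" using nv zero_le_power2[of "norm v"] by linarith
  then show "0 < fst (snd (initial_state u))" by (simp add: i)
  have "residual ((x, s, y), (s \<bullet> x + \<sigma>, v)) $ j = \<sigma>" for j
    by (cases j) (simp_all add: residual_def v2)
  then show "initial_state u \<in> interior_F A b c"
    using assms nv p \<sigma> unfolding i by (simp add: interior_F_def control_set_def u)
qed

text \<open>Corrector steps keep the control and predictor steps scale it by \<open>1 - \<alpha>\<close>.\<close>

lemma run_invariant:
  fixes z :: "nat \<Rightarrow> ('n::finite, 'm::finite) state"
  assumes run: "ptfm2_run A b c r \<epsilon> \<eta> K z" and "k \<le> K"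
  shows "z k \<in> interior_F A b c \<and> (\<exists>\<gamma>. 0 < \<gamma> \<and> \<gamma> \<le> 1 \<and> snd (z k) = \<gamma> *\<^sub>R snd (z 0))"
  using \<open>k \<le> K\<close>
proof (induction k)
  case 0
  have "z 0 \<in> interior_F A b c"
    using run initial_state_properties(1) by (auto simp: ptfm2_run_def)
  then show ?case by (auto intro!: exI[of _ 1])
next
  case (Suc k)
  then obtain \<gamma> where \<gamma>: "0 < \<gamma>" "\<gamma> \<le> 1" "snd (z k) = \<gamma> *\<^sub>R snd (z 0)" by auto
  have step: "if predictor_test r (z k) then predictor_step A b c r (z k) (z (Suc k))
      else corrector_step A b c (\<eta> k) (z k) (z (Suc k))"
    using run Suc.prems by (auto simp: ptfm2_run_def)
  show ?case
  proof (cases "predictor_test r (z k)")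
    case True
    obtain x s y v0 v where zk: "z k = ((x, s, y), (v0, v))" by (metis surj_pair)
    from True step have "predictor_step A b c r (z k) (z (Suc k))" by simp
    then obtain \<alpha> where \<alpha>: "0 < \<alpha>" "\<alpha> < 1" "snd (z (Suc k)) = (1 - \<alpha>) *\<^sub>R snd (z k)"
      "z (Suc k) \<in> interior_F A b c"
      unfolding predictor_step_def zk prod.case Let_def by auto
    have "(1 - \<alpha>) * \<gamma> \<le> 1" using \<alpha> \<gamma> by (intro mult_le_one) auto
    moreover have "0 < (1 - \<alpha>) * \<gamma>" using \<alpha> \<gamma> by simp
    ultimately show ?thesis
      using \<alpha>(3,4) \<gamma>(3) by (auto intro!: exI[of _ "(1 - \<alpha>) * \<gamma>"])
  next
    case False
    with step have "corrector_step A b c (\<eta> k) (z k) (z (Suc k))" by simp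
    then have "snd (z (Suc k)) = snd (z k)" "z (Suc k) \<in> interior_F A b c"
      by (auto simp: corrector_step_def Let_def)
    then show ?thesis using \<gamma> by auto
  qed
qed

theorem mainTheorem12:
  fixes A :: "real ^ ('m::finite + 'k::finite) ^ 'm"
    and b :: "real ^ 'm"
    and c xs :: "real ^ ('m + 'k)"
    and r \<epsilon> :: real
    and \<eta> :: "nat \<Rightarrow> real"
    and K :: nat
    and z :: "nat \<Rightarrow> ('m + 'k, 'm) state"
  defines "n \<equiv> real CARD('m + 'k)"
    and "\<kappa> \<equiv> kappa A"
    and "\<pi>\<^sub>s \<equiv> pi_star A c xs"
    and "f \<equiv> \<lambda>k. fst (snd (z k))"
  assumes "strictly_feasible A b c \<noteq> {}"
    and "\<And>x. primal_solution A b c x \<longleftrightarrow> x = xs"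
    and "\<And>i. xs $ Inl i > 0" and "\<And>l. xs $ Inr l = 0"
    and "invertible (basic_block A)"
    and "\<And>l. s_star A c $ Inr l > 0"
    and "0 < r" and "r < 1"
    and "ptfm2_run A b c r \<epsilon> \<eta> K z"
    and "f 0 \<le> \<pi>\<^sub>s / (4 * \<kappa>)"
  shows "\<forall>k<K. predictor_test r (z k) \<and> f k < f 0 \<longrightarrow>
           f (Suc k) \<le> 5 * (n + 1) * (1 + \<kappa>\<^sup>2) * c3 r / (\<pi>\<^sub>s * r * (f 0 - f k)) * f k ^ 3 \<and>
           5 * (n + 1) * (1 + \<kappa>\<^sup>2) * c3 r / (\<pi>\<^sub>s * r * (f 0 - f k)) * f k ^ 3
             \<le> (n + 1) * (1 / \<kappa> + \<kappa>) * (5 * c3 r * f k ^ 3 / (4 * r * f 0 * (f 0 - f k)))"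
proof (intro allI impI, elim conjE)
  fix k assume kK: "k < K" and test: "predictor_test r (z k)" and fk: "f k < f 0"
  note run = \<open>ptfm2_run A b c r \<epsilon> \<eta> K z\<close> and r = \<open>0 < r\<close> \<open>r < 1\<close>
  define p where "p = Min (range (\<lambda>i::'m. xs $ Inl i))"
  define q where "q = Min (range (\<lambda>l::'k. s_star A c $ Inr l))"
  have p_le: "p \<le> xs $ Inl i" for i unfolding p_def by (rule Min_le) auto
  have q_le: "q \<le> s_star A c $ Inr l" for l unfolding q_def by (rule Min_le) auto
  have pq: "0 < p" "0 < q"
    using assms(7,10) by (auto simp: p_def q_def)
  have \<pi>: "\<pi>\<^sub>s = p * q" by (simp add: \<pi>\<^sub>s_def pi_star_def p_def q_def)
  have Axs: "A *v xs = b"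
    using assms(6)[of xs] by (simp add: primal_solution_def primal_feasible_def)
  obtain u0 where u0: "u0 \<in> strictly_feasible A b c" "z 0 = initial_state u0"
    using run by (auto simp: ptfm2_run_def)
  have f0: "0 < f 0" and v0: "(norm (snd (snd (z 0))))\<^sup>2 \<le> f 0"
    using initial_state_properties(2,3)[OF u0(1)] by (simp_all add: f_def u0(2))
  \<comment> \<open>If \<open>\<kappa>\<close> were zero, the bound on \<open>f 0\<close> would read \<open>f 0 \<le> 0\<close> because \<open>a / 0 = 0\<close>.\<close>
  have \<kappa>: "0 < \<kappa>"
    using assms(14) f0 kappa_nonneg[of A] by (cases "\<kappa> = 0") (auto simp: \<kappa>_def)
  have kf: "\<kappa> * f 0 \<le> p * q / 4"
    using assms(14) \<kappa> by (simp add: \<pi> field_simps)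
  obtain \<gamma> where zk: "z k \<in> interior_F A b c" and \<gamma>: "0 < \<gamma>" "snd (z k) = \<gamma> *\<^sub>R snd (z 0)"
    using run_invariant[OF run, of k] kK by auto
  have f\<gamma>: "f k = \<gamma> * f 0" by (simp add: f_def \<gamma>(2))
  have "(norm (snd (snd (z k))))\<^sup>2 = \<gamma>\<^sup>2 * (norm (snd (snd (z 0))))\<^sup>2"
    by (simp add: \<gamma>(2) power_mult_distrib)
  also have "\<dots> \<le> \<gamma>\<^sup>2 * f 0" using v0 by (intro mult_left_mono) auto
  also have "\<dots> = (f k)\<^sup>2 / f 0" using f0 by (simp add: f\<gamma> power2_eq_square)
  finally have vk: "(norm (snd (snd (z k))))\<^sup>2 \<le> (f k)\<^sup>2 / f 0" .
  have step: "predictor_step A b c r (z k) (z (Suc k))"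
    using run kK test by (auto simp: ptfm2_run_def)
  have "fst (snd (z (Suc k))) \<le> 5 * (n + 1) * (1 + \<kappa>\<^sup>2) * c3 r / (\<pi>\<^sub>s * r * (f 0 - f k)) * f k ^ 3"
    unfolding n_def \<pi> \<kappa>_def
    by (rule predictor_contraction[OF assms(9) Axs assms(8) p_le q_le pq r zk test step _ fk vk
          kf[unfolded \<kappa>_def]]) (simp add: f_def)
  then have "f (Suc k) \<le> 5 * (n + 1) * (1 + \<kappa>\<^sup>2) * c3 r / (\<pi>\<^sub>s * r * (f 0 - f k)) * f k ^ 3"
    by (simp only: f_def)
  moreover have "5 * (n + 1) * (1 + \<kappa>\<^sup>2) * c3 r / (\<pi>\<^sub>s * r * (f 0 - f k)) * f k ^ 3
      \<le> (n + 1) * (1 / \<kappa> + \<kappa>) * (5 * c3 r * f k ^ 3 / (4 * r * f 0 * (f 0 - f k)))"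
  proof -
    let ?C = "5 * (n + 1) * c3 r * f k ^ 3 / (r * (f 0 - f k))"
    have C: "0 \<le> ?C"
      using c3_ge[of r] r fk f0 \<gamma>(1) by (simp add: f\<gamma> n_def)
    have "5 * (n + 1) * (1 + \<kappa>\<^sup>2) * c3 r / (\<pi>\<^sub>s * r * (f 0 - f k)) * f k ^ 3
        = ?C * ((1 + \<kappa>\<^sup>2) / (p * q))"
      by (simp add: \<pi> mult_ac)
    also have "\<dots> \<le> ?C * ((1 + \<kappa>\<^sup>2) / (4 * (\<kappa> * f 0)))"
      using kf \<kappa> f0 pq by (intro mult_left_mono[OF _ C] divide_left_mono) auto
    also have "(1 + \<kappa>\<^sup>2) / (4 * (\<kappa> * f 0)) = (1 / \<kappa> + \<kappa>) / (4 * f 0)"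
      using \<kappa> f0 by (simp add: field_simps power2_eq_square)
    also have "?C * ((1 / \<kappa> + \<kappa>) / (4 * f 0))
        = (n + 1) * (1 / \<kappa> + \<kappa>) * (5 * c3 r * f k ^ 3 / (4 * r * f 0 * (f 0 - f k)))"
      by (simp add: mult_ac)
    finally show ?thesis .
  qed
  ultimately show "f (Suc k) \<le> 5 * (n + 1) * (1 + \<kappa>\<^sup>2) * c3 r / (\<pi>\<^sub>s * r * (f 0 - f k)) * f k ^ 3 \<and>
           5 * (n + 1) * (1 + \<kappa>\<^sup>2) * c3 r / (\<pi>\<^sub>s * r * (f 0 - f k)) * f k ^ 3
             \<le> (n + 1) * (1 / \<kappa> + \<kappa>) * (5 * c3 r * f k ^ 3 / (4 * r * f 0 * (f 0 - f k)))" ..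
qed

end
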